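(* Let $t$ be a positive integer and $\nu$ a partition with $t$-quotients $\nu^0,\dots,\nu^{t-1}$. Then there exist rational numbers $b_{\delta^0,\dots,\delta^{t-1}}$, independent of $\lambda$, indexed by $t$-tuples of partitions $(\delta^0,\dots,\delta^{t-1})$ with $\sum_{i=0}^{t-1}|\delta^i|\le\sum_{i=0}^{t-1}|\nu^i|-2$, such that for every partition $\lambda$ (with $t$-quotients $\lambda^0,\dots,\lambda^{t-1}$) $$D_t\Bigl(G_\lambda\prod_{i=0}^{t-1}q_{\nu^i}(\lambda^i)\Bigr)=\sum b_{\delta^0,\dots,\delta^{t-1}}\,G_\lambda\prod_{i=0}^{t-1}q_{\delta^i}(\lambda^i).$$ Furthermore, if $r\ge\frac12\sum_{i=0}^{t-1}|\nu^i|+1$, then $D_t^r\bigl(G_\lambda\prod_{i=0}^{t-1}q_{\nu^i}(\lambda^i)\bigr)=0$ for every partition $\lambda$.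
   Context: Partitions are identified with Young diagrams (box $(i,j)$ in row $i$, column $j$; content $j-i$); $\mathcal H(\lambda)$ is the multiset of hook lengths (for a box: boxes to its right in its row, plus below it in its column, plus one). $G_\lambda=1/\prod_{h\in\mathcal H(\lambda),\,t\mid h}h$. Corners: for a partition $\lambda$, let $(\alpha_1,\beta_1),\dots,(\alpha_m,\beta_m)$ be the boxes whose removal leaves a Young diagram (outer corners), with $\alpha_1>\dots>\alpha_m$; set $\alpha_{m+1}=\beta_0=0$, $y_j=\beta_j-\alpha_j$ ($1\le j\le m$) and $x_i=\beta_i-\alpha_{i+1}$ ($0\le i\le m$) (for $\lambda=\emptyset$, $m=0$, $x_0=0$). Define $q_k(\lambda)=\sum_{i=0}^m x_i^k-\sum_{j=1}^m y_j^k$ for integers $k\ge0$ (with $0^0=1$) and, for a partition $\delta=(\delta_1,\dots,\delta_\ell)$, $q_\delta(\lambda)=\prod_{s=1}^\ell q_{\delta_s}(\lambda)$ (so $q_\emptyset=1$). The 01-sequence $(z_i)_{i\in\mathbb Z}$ of $\lambda$: traverse the boundary of its Young diagram from the bottom (infinite vertical ray below the first column) to the right (infinite horizontal ray right of the first row), labelling vertical edges $0$ and horizontal edges $1$, indexed so that $\#\{i\ge0:z_i=0\}=\#\{i<0:z_i=1\}$. For $0\le i\le t-1$ the $i$-th $t$-quotient $\lambda^i$ is the partition whose 01-sequence is $(z_{tj+i})_{j\in\mathbb Z}$ (the partition does not depend on re-indexing). Adding a $t$-hook means exchanging some $z_i=0,z_{i+t}=1$ into $1,0$. For a function $g$ on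 partitions, $D_tg(\lambda)=\sum_{\lambda^+}g(\lambda^+)-g(\lambda)$ over all $\lambda^+$ obtained from $\lambda$ by adding one $t$-hook; $D_t^0g=g$, $D_t^rg=D_t(D_t^{r-1}g)$. *)

theory Defs
  imports Complex_Main "HOL-Library.Multiset" "HOL-Library.FuncSet"
begin

definition is_partition :: "nat list \<Rightarrow> bool" where
  "is_partition p \<longleftrightarrow> sorted_wrt (\<ge>) p \<and> (\<forall>x\<in>set p. 0 < x)"

text \<open>Boxes are 1-based pairs (row, column).\<close>

definition young_diagram :: "nat list \<Rightarrow> (nat \<times> nat) set" where
  "young_diagram p = {(i, j). 1 \<le> i \<and> i \<le> length p \<and> 1 \<le> j \<and> j \<le> p ! (i - 1)}"

definition hook_length :: "nat list \<Rightarrow> nat \<times> nat \<Rightarrow> nat" where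
  "hook_length p = (\<lambda>(i, j).
     card {j'. j < j' \<and> (i, j') \<in> young_diagram p} +
     card {i'. i < i' \<and> (i', j) \<in> young_diagram p} + 1)"

definition hook_lengths :: "nat list \<Rightarrow> nat multiset" where
  "hook_lengths p = image_mset (hook_length p) (mset_set (young_diagram p))"

definition G :: "nat \<Rightarrow> nat list \<Rightarrow> rat" where
  "G t p = 1 / (\<Prod>h \<in># filter_mset (\<lambda>h. t dvd h) (hook_lengths p). of_nat h)"

definition outer_corners :: "nat list \<Rightarrow> (nat \<times> nat) set" where
  "outer_corners p = {c \<in> young_diagram p.
     \<exists>p'. is_partition p' \<and> young_diagram p' = young_diagram p - {c}}"

text \<open>The outer corners in order of decreasing row (there is at most one per row).\<close>

definition corner_list :: "nat list \<Rightarrow> (nat \<times> nat) list" where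
  "corner_list p = rev (sorted_key_list_of_set fst (outer_corners p))"

text \<open>Coordinates of the \<open>j\<close>-th corner, \<open>1 \<le> j \<le> m\<close>; the value \<open>0\<close> outside this range
  supplies the conventions \<open>\<alpha>\<^sub>m\<^sub>+\<^sub>1 = \<beta>\<^sub>0 = 0\<close>.\<close>

definition corner_row :: "nat list \<Rightarrow> nat \<Rightarrow> int" where
  "corner_row p j =
     (if 1 \<le> j \<and> j \<le> length (corner_list p) then int (fst (corner_list p ! (j - 1))) else 0)"

definition corner_col :: "nat list \<Rightarrow> nat \<Rightarrow> int" where
  "corner_col p j =
     (if 1 \<le> j \<and> j \<le> length (corner_list p) then int (snd (corner_list p ! (j - 1))) else 0)"

definition y_content :: "nat list \<Rightarrow> nat \<Rightarrow> int" where
  "y_content p j = corner_col p j - corner_row p j"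

definition x_content :: "nat list \<Rightarrow> nat \<Rightarrow> int" where
  "x_content p i = corner_col p i - corner_row p (i + 1)"

definition q :: "nat \<Rightarrow> nat list \<Rightarrow> rat" where
  "q k p = of_int ((\<Sum>i = 0..length (corner_list p). x_content p i ^ k)
                 - (\<Sum>j = 1..length (corner_list p). y_content p j ^ k))"

definition q_part :: "nat list \<Rightarrow> nat list \<Rightarrow> rat" where
  "q_part \<delta> p = (\<Prod>k\<leftarrow>\<delta>. q k p)"

text \<open>The lattice point \<open>(a, b)\<close> lies \<open>a\<close> rows below and \<open>b\<close> columns right of the top left
  corner of the diagram; it is the lower right vertex of the box \<open>(a, b)\<close> and the upper left
  vertex of the box \<open>(a + 1, b + 1)\<close>. The two rays belong to the boundary.\<close>

definition boundary_points :: "nat list \<Rightarrow> (nat \<times> nat) set" where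
  "boundary_points p = {(a, b).
     (a = 0 \<or> b = 0 \<or> (a, b) \<in> young_diagram p) \<and> (a + 1, b + 1) \<notin> young_diagram p}"

text \<open>\<open>z\<close> is the word of edge labels met while traversing the boundary from the bottom to the
  right, with an arbitrary choice of the edge that gets index \<open>0\<close>.\<close>

definition boundary_word :: "nat list \<Rightarrow> (int \<Rightarrow> nat) \<Rightarrow> bool" where
  "boundary_word p z \<longleftrightarrow> (\<exists>v :: int \<Rightarrow> nat \<times> nat. range v = boundary_points p \<and>
     (\<forall>k. z k = 0 \<and> fst (v k) = fst (v (k + 1)) + 1 \<and> snd (v k) = snd (v (k + 1)) \<or>
          z k = 1 \<and> fst (v (k + 1)) = fst (v k) \<and> snd (v (k + 1)) = snd (v k) + 1))"

text \<open>For a boundary word the two sets below are finite, so that \<open>card\<close> is meaningful.\<close>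

definition zero_one_seq :: "nat list \<Rightarrow> int \<Rightarrow> nat" where
  "zero_one_seq p = (THE z. boundary_word p z \<and>
     card {i. 0 \<le> i \<and> z i = 0} = card {i. i < 0 \<and> z i = 1})"

text \<open>The subsequence need not be balanced, hence \<open>boundary_word\<close> and not \<open>zero_one_seq\<close>.\<close>

definition t_quotient :: "nat \<Rightarrow> nat list \<Rightarrow> nat \<Rightarrow> nat list" where
  "t_quotient t p i = (THE p'. is_partition p' \<and>
     boundary_word p' (\<lambda>j. zero_one_seq p (int t * j + int i)))"

definition adds_hook :: "nat \<Rightarrow> nat list \<Rightarrow> nat list \<Rightarrow> bool" where
  "adds_hook t p p' \<longleftrightarrow> is_partition p' \<and>
     (\<exists>k. zero_one_seq p k = 0 \<and> zero_one_seq p (k + int t) = 1 \<and>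
          zero_one_seq p' = (zero_one_seq p)(k := 1, k + int t := 0))"

definition D_t :: "nat \<Rightarrow> (nat list \<Rightarrow> rat) \<Rightarrow> nat list \<Rightarrow> rat" where
  "D_t t g p = (\<Sum>p' | adds_hook t p p'. g p') - g p"

end

theory Submission
  imports Defs "HOL-Computational_Algebra.Polynomial_FPS"
begin

text \<open>
  Everything is read off the 01-word \<open>w\<close> of a partition. Boxes are the inversions
  \<open>i < j\<close>, \<open>w i = 1\<close>, \<open>w j = 0\<close>, with hook length \<open>j - i\<close>, and the \<open>x\<close>'s and
  \<open>y\<close>'s of the corners are the positions of the factors 01 and 10. Hence \<open>G t\<close> is a product over
  the quotients of \<open>1 / \<Prod>(t * h)\<close>, and adding a \<open>t\<close>-hook is adding one box to one quotient.

  Adding a box at \<open>x\<close> multiplies \<open>G t\<close> by \<open>1 / t\<close> times the Lagrange weight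
  \<open>\<Prod>y. (x - y) / \<Prod>x' \<noteq> x. (x - x')\<close>. The weights sum to \<open>1\<close>, and their \<open>r\<close>-th moment is a
  polynomial of weight \<open>r\<close> in the \<open>q k\<close>. The box changes \<open>q k\<close> by
  \<open>(x + 1)^k + (x - 1)^k - 2 * x^k\<close>, which has degree at most \<open>k - 2\<close> in \<open>x\<close>. So \<open>D_t t\<close> lowers
  the weight by \<open>2\<close>, and functions of negative weight vanish.
\<close>

subsection \<open>01-words\<close>

text \<open>The loss of weight rests on a cancellation. Each of the \<open>t\<close> quotients
  receives its boxes with total weight \<open>1\<close>, and the factor \<open>1 / t\<close> turns
  the \<open>t\<close> contributions into a mean. The part in which the \<open>q\<close>-product
  keeps its old value therefore adds up to exactly the term that \<open>D_t t\<close> subtracts, and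
  only the change of the \<open>q\<close>-product survives. Two obstacles shape the proof. The
  quotient words of a balanced word need not be balanced, so words carry a \<open>charge\<close>,
  and contents are positions minus charge. Moreover the operator is iterated and the coefficients
  must not depend on the partition. Hence the argument runs over a class of functions that the
  operator preserves up to the factor \<open>G t\<close>, and the content of the added box stays a
  separate variable until it is averaged away into moments.\<close>

definition maya :: "(int \<Rightarrow> nat) \<Rightarrow> bool" where
  "maya w \<longleftrightarrow> (\<forall>k. w k = 0 \<or> w k = 1) \<and> (\<exists>l u. (\<forall>k<l. w k = 0) \<and> (\<forall>k\<ge>u. w k = 1))"

definition zeros :: "(int \<Rightarrow> nat) \<Rightarrow> int \<Rightarrow> nat" where
  "zeros w k = card {j. k \<le> j \<and> w j = 0}"

definition ones :: "(int \<Rightarrow> nat) \<Rightarrow> int \<Rightarrow> nat" where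
  "ones w k = card {j. j < k \<and> w j = 1}"

text \<open>The index of the boundary point on the main diagonal, hence the shift between positions
  and contents. Balanced words are those of charge \<open>0\<close>.\<close>

definition charge :: "(int \<Rightarrow> nat) \<Rightarrow> int" where
  "charge w = int (zeros w 0) - int (ones w 0)"

lemma maya_01: "maya w \<Longrightarrow> w k = 0 \<or> w k = 1"
  by (simp add: maya_def)

lemma maya_bounds:
  assumes "maya w"
  obtains l u where "l \<le> b" "a \<le> u" "l < u" "\<And>k. k < l \<Longrightarrow> w k = 0" "\<And>k. k \<ge> u \<Longrightarrow> w k = 1"
proof -
  obtain l u where lu: "\<forall>k<l. w k = 0" "\<forall>k\<ge>u. w k = 1"
    using assms by (auto simp: maya_def)
  show ?thesis
    by (rule that[of "min l b" "max (max u a) (min l b + 1)"]) (use lu in auto)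
qed

lemma finite_zeros: "maya w \<Longrightarrow> finite {j. k \<le> j \<and> w j = 0}"
proof -
  assume "maya w"
  then obtain l u where "\<And>k. k \<ge> u \<Longrightarrow> w k = 1" by (rule maya_bounds[of w 0 0]) blast
  then have "{j. k \<le> j \<and> w j = 0} \<subseteq> {k..u}"
    by (metis (mono_tags, lifting) atLeastAtMost_iff linorder_le_cases mem_Collect_eq subsetI zero_neq_one)
  then show ?thesis by (rule finite_subset) simp
qed

lemma finite_ones: "maya w \<Longrightarrow> finite {j. j < k \<and> w j = 1}"
proof -
  assume "maya w"
  then obtain l u where "\<And>k. k < l \<Longrightarrow> w k = 0" by (rule maya_bounds[of w 0 0]) blast
  then have "{j. j < k \<and> w j = 1} \<subseteq> {l..k}"
    by (smt (verit, best) atLeastAtMost_iff mem_Collect_eq subsetI zero_neq_one)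
  then show ?thesis by (rule finite_subset) simp
qed

lemma zeros_step0:
  assumes "maya w" "w k = 0"
  shows "zeros w k = Suc (zeros w (k + 1))"
proof -
  have "{j. k \<le> j \<and> w j = 0} = insert k {j. k + 1 \<le> j \<and> w j = 0}"
    using assms by auto
  then show ?thesis
    using finite_zeros[OF assms(1), of "k+1"] by (simp add: zeros_def)
qed

lemma zeros_step1:
  assumes "w k = 1"
  shows "zeros w k = zeros w (k + 1)"
proof -
  have "{j. k \<le> j \<and> w j = 0} = {j. k + 1 \<le> j \<and> w j = 0}"
    using assms by (auto simp: order_le_less)
  then show ?thesis by (simp add: zeros_def)
qed

lemma ones_step0:
  assumes "w k = 0"
  shows "ones w (k + 1) = ones w k"
proof -
  have "{j. j < k + 1 \<and> w j = 1} = {j. j < k \<and> w j = 1}"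
    using assms by (auto simp: order_le_less)
  then show ?thesis by (simp add: ones_def)
qed

lemma ones_step1:
  assumes "maya w" "w k = 1"
  shows "ones w (k + 1) = Suc (ones w k)"
proof -
  have "{j. j < k + 1 \<and> w j = 1} = insert k {j. j < k \<and> w j = 1}"
    using assms by auto
  then show ?thesis
    using finite_ones[OF assms(1), of k] by (simp add: ones_def)
qed

lemma zeros_antimono: "maya w \<Longrightarrow> k \<le> l \<Longrightarrow> zeros w l \<le> zeros w k"
  unfolding zeros_def by (rule card_mono) (auto intro: finite_zeros)

lemma ones_mono: "maya w \<Longrightarrow> k \<le> l \<Longrightarrow> ones w k \<le> ones w l"
  unfolding ones_def by (rule card_mono) (auto intro: finite_ones[unfolded One_nat_def])

text \<open>Every edge raises column minus row by one: a vertical edge lowers the row, a horizontal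
  one raises the column. So the boundary point before edge \<open>k\<close> has content
  \<open>k - charge w\<close>.\<close>

lemma ones_minus_zeros:
  assumes "maya w"
  shows "int (ones w k) - int (zeros w k) = k - charge w"
proof (induction k rule: int_induct[of _ 0])
  case base
  show ?case by (simp add: charge_def)
next
  case (step1 i)
  then show ?case
    using maya_01[OF assms, of i] zeros_step0[OF assms, of i] zeros_step1[of w i]
      ones_step0[of w i] ones_step1[OF assms, of i] by fastforce
next
  case (step2 i)
  then show ?case
    using maya_01[OF assms, of "i-1"] zeros_step0[OF assms, of "i-1"] zeros_step1[of w "i-1"]
      ones_step0[of w "i-1"] ones_step1[OF assms, of "i-1"] by fastforce
qed

lemma zeros_lt: "maya w \<Longrightarrow> w k = 0 \<Longrightarrow> k < l \<Longrightarrow> zeros w l < zeros w k"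
  using zeros_step0[of w k] zeros_antimono[of w "k+1" l] by simp

lemma ones_lt: "maya w \<Longrightarrow> w k = 1 \<Longrightarrow> k < l \<Longrightarrow> ones w k < ones w l"
  using ones_step1[of w k] ones_mono[of w "k+1" l] by simp

lemma zeros_inj: "maya w \<Longrightarrow> w k = 0 \<Longrightarrow> w l = 0 \<Longrightarrow> zeros w k = zeros w l \<Longrightarrow> k = l"
  by (metis linorder_neqE_linordered_idom nat_neq_iff zeros_lt)

lemma ones_inj: "maya w \<Longrightarrow> w k = 1 \<Longrightarrow> w l = 1 \<Longrightarrow> ones w k = ones w l \<Longrightarrow> k = l"
  by (metis linorder_neqE_linordered_idom nat_neq_iff ones_lt)

lemma zeros_eq_0: "(\<And>j. j \<ge> k \<Longrightarrow> w j = 1) \<Longrightarrow> zeros w k = 0"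
  unfolding zeros_def by (metis (mono_tags, lifting) card.empty empty_Collect_eq zero_neq_one)

lemma ones_eq_0: "(\<And>j. j < k \<Longrightarrow> w j = 0) \<Longrightarrow> ones w k = 0"
  unfolding ones_def by (metis (mono_tags, lifting) card.empty empty_Collect_eq zero_neq_one)

lemma ex_zeros_ge:
  assumes "maya w"
  shows "\<exists>k. a \<le> zeros w k"
proof -
  obtain l u where lu: "l \<le> charge w - int a" "\<And>k. k < l \<Longrightarrow> w k = 0"
    using maya_bounds[OF assms] by metis
  then have "ones w l = 0" by (intro ones_eq_0) auto
  with lu ones_minus_zeros[OF assms, of l] show ?thesis by (intro exI[of _ l]) simp
qed

lemma ex_ones_ge:
  assumes "maya w"
  shows "\<exists>k. b \<le> ones w k"
proof -
  obtain l u where lu: "u \<ge> charge w + int b" "\<And>k. k \<ge> u \<Longrightarrow> w k = 1"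
    using maya_bounds[OF assms] by metis
  then have "zeros w u = 0" by (intro zeros_eq_0) auto
  with lu ones_minus_zeros[OF assms, of u] show ?thesis by (intro exI[of _ u]) simp
qed

lemma ex_zero_row:
  assumes "maya w" "1 \<le> a"
  obtains j where "w j = 0" "zeros w j = a"
proof -
  obtain k where k: "a \<le> zeros w k" using ex_zeros_ge[OF assms(1)] by blast
  obtain l u where u: "k \<le> u" "\<And>k. k \<ge> u \<Longrightarrow> w k = 1"
    using maya_bounds[OF assms(1)] by metis
  then have zu: "zeros w u = 0" by (intro zeros_eq_0) auto
  \<comment> \<open>The last position with at least \<open>a\<close> zeros from there on is itself a
    zero, since the count drops right after it.\<close>
  define j where "j = Max {i \<in> {k..u}. a \<le> zeros w i}"
  have fin: "finite {i \<in> {k..u}. a \<le> zeros w i}"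
    by (rule finite_subset[of _ "{k..u}"]) auto
  have "j \<in> {i \<in> {k..u}. a \<le> zeros w i}"
    unfolding j_def by (rule Max_in[OF fin]) (use k u in auto)
  then have j: "k \<le> j" "j \<le> u" "a \<le> zeros w j" by auto
  with zu assms(2) have "j < u" by (cases "j = u") auto
  then have j1: "\<not> a \<le> zeros w (j + 1)"
    using Max_ge[OF fin, folded j_def, of "j+1"] j by auto
  then have "w j = 0" using zeros_step1[of w j] maya_01[OF assms(1), of j] j by auto
  moreover have "zeros w j = a" using zeros_step0[OF assms(1) calculation] j j1 by simp
  ultimately show ?thesis by (rule that)
qed

lemma ex_one_col:
  assumes "maya w" "1 \<le> b"
  obtains i where "w i = 1" "Suc (ones w i) = b"
proof -
  obtain k where k: "b \<le> ones w k" using ex_ones_ge[OF assms(1)] by blast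
  obtain l u where u: "l \<le> k" "\<And>k. k < l \<Longrightarrow> w k = 0"
    using maya_bounds[OF assms(1)] by metis
  then have zu: "ones w l = 0" by (intro ones_eq_0) auto
  define j where "j = Min {i \<in> {l..k}. b \<le> ones w i}"
  have fin: "finite {i \<in> {l..k}. b \<le> ones w i}"
    by (rule finite_subset[of _ "{l..k}"]) auto
  have "j \<in> {i \<in> {l..k}. b \<le> ones w i}"
    unfolding j_def by (rule Min_in[OF fin]) (use k u in auto)
  then have j: "l \<le> j" "j \<le> k" "b \<le> ones w j" by auto
  with zu assms(2) have "l < j" by (cases "j = l") auto
  then have j1: "\<not> b \<le> ones w (j - 1)"
    using Min_le[OF fin, folded j_def, of "j-1"] j by auto
  then have "w (j-1) = 1" using ones_step0[of w "j-1"] maya_01[OF assms(1), of "j-1"] j by auto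
  moreover have "Suc (ones w (j-1)) = b"
    using ones_step1[OF assms(1) calculation] j j1 by simp
  ultimately show ?thesis by (rule that)
qed

subsection \<open>Partitions and words\<close>

text \<open>The boundary point at the start of edge \<open>k\<close> is \<open>(zeros w k, ones w k)\<close>.\<close>

definition diagram :: "(int \<Rightarrow> nat) \<Rightarrow> (nat \<times> nat) set" where
  "diagram w = {(a, b). 1 \<le> a \<and> 1 \<le> b \<and> (\<exists>k. a \<le> zeros w k \<and> b \<le> ones w k)}"

text \<open>The zero at \<open>j\<close> is the vertical edge that closes row
  \<open>zeros w j\<close>, and the length of this row is the number of horizontal edges met
  before.\<close>

lemma diagram_row:
  assumes "maya w" "w j = 0"
  shows "(zeros w j, b) \<in> diagram w \<longleftrightarrow> 1 \<le> b \<and> b \<le> ones w j"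
proof -
  have "b \<le> ones w j" if "zeros w j \<le> zeros w k" "b \<le> ones w k" for k
  proof -
    have "k \<le> j" using zeros_lt[OF assms, of k] that by force
    then show ?thesis using ones_mono[OF assms(1)] that by force
  qed
  moreover have "1 \<le> zeros w j" using zeros_step0[OF assms] by simp
  ultimately show ?thesis by (auto simp: diagram_def)
qed

lemma diagram_col:
  assumes "maya w" "w i = 1"
  shows "(a, Suc (ones w i)) \<in> diagram w \<longleftrightarrow> 1 \<le> a \<and> a \<le> zeros w i"
proof -
  have "a \<le> zeros w i" if "a \<le> zeros w k" "Suc (ones w i) \<le> ones w k" for k
  proof -
    have "i + 1 \<le> k" using ones_mono[OF assms(1), of k i] that by force
    then show ?thesis
      using zeros_antimono[OF assms(1), of "i+1" k] zeros_step1[of w i] assms(2) that by force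
  qed
  moreover have "a \<le> zeros w i \<Longrightarrow> \<exists>k. a \<le> zeros w k \<and> Suc (ones w i) \<le> ones w k"
    using zeros_step1[of w i] assms(2) ones_step1[OF assms] by (intro exI[of _ "i+1"]) simp
  ultimately show ?thesis by (auto simp: diagram_def)
qed

text \<open>The condition of \<open>boundary_points\<close> for an arbitrary set of boxes, so that
  it applies to \<open>diagram w\<close> without a partition at hand.\<close>

definition is_boundary :: "(nat \<times> nat) set \<Rightarrow> nat \<times> nat \<Rightarrow> bool" where
  "is_boundary D = (\<lambda>(a, b). (a = 0 \<or> b = 0 \<or> (a, b) \<in> D) \<and> (a + 1, b + 1) \<notin> D)"

lemma is_boundary_diagram_iff:
  assumes "maya w"
  shows "is_boundary (diagram w) (a, b) \<longleftrightarrow> (\<exists>k. a = zeros w k \<and> b = ones w k)"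
proof
  assume L: "is_boundary (diagram w) (a, b)"
  \<comment> \<open>The index of the boundary point on the diagonal of \<open>(a, b)\<close>. A
    boundary point can lie neither strictly below nor strictly above it on that diagonal.\<close>
  define k where "k = int b - int a + charge w"
  have k: "int (ones w k) - int (zeros w k) = int b - int a"
    using ones_minus_zeros[OF assms, of k] by (simp add: k_def)
  have "\<not> a > zeros w k"
  proof
    assume a: "a > zeros w k"
    with k have b: "b > ones w k" by linarith
    with a L have "(a, b) \<in> diagram w" by (auto simp: is_boundary_def)
    then obtain k' where k': "a \<le> zeros w k'" "b \<le> ones w k'" by (auto simp: diagram_def)
    have "k' < k" using zeros_antimono[OF assms, of k k'] k' a by force
    then show False using ones_mono[OF assms, of k' k] k' b by force
  qed
  moreover have "\<not> a < zeros w k"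
  proof
    assume a: "a < zeros w k"
    with k have b: "b < ones w k" by linarith
    with a have "(a + 1, b + 1) \<in> diagram w" by (auto simp: diagram_def intro!: exI[of _ k])
    with L show False by (auto simp: is_boundary_def)
  qed
  ultimately show "\<exists>k. a = zeros w k \<and> b = ones w k" using k by (intro exI[of _ k]) auto
next
  assume "\<exists>k. a = zeros w k \<and> b = ones w k"
  then obtain k where k: "a = zeros w k" "b = ones w k" by blast
  have "False" if "a + 1 \<le> zeros w k'" "b + 1 \<le> ones w k'" for k'
  proof -
    have "k' < k" using zeros_antimono[OF assms, of k k'] that k by force
    then show False using ones_mono[OF assms, of k' k] that k by force
  qed
  with k show "is_boundary (diagram w) (a, b)" by (auto simp: is_boundary_def diagram_def)
qed

lemma boundary_point_unique:
  assumes "maya w" "zeros w k = zeros w' k'" "ones w k = ones w' k'" "maya w'"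
  shows "k - charge w = k' - charge w'"
  using ones_minus_zeros[OF assms(1), of k] ones_minus_zeros[OF assms(4), of k'] assms(2,3) by linarith

text \<open>The diagram fixes the boundary points, the charge fixes their numbering by content, and
  the letter at \<open>k\<close> tells which coordinate changes between \<open>k\<close> and
  \<open>k + 1\<close>.\<close>

lemma diagram_inj:
  assumes "maya w" "maya w'" "diagram w = diagram w'" "charge w = charge w'"
  shows "w = w'"
proof
  have eq: "zeros w k = zeros w' k \<and> ones w k = ones w' k" for k
  proof -
    have "is_boundary (diagram w') (zeros w k, ones w k)"
      using is_boundary_diagram_iff[OF assms(1)] assms(3) by metis
    then obtain k' where k': "zeros w k = zeros w' k'" "ones w k = ones w' k'"
      using is_boundary_diagram_iff[OF assms(2)] by metis
    then have "k = k'"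
      using boundary_point_unique[OF assms(1) k' assms(2)] assms(4) by simp
    with k' show ?thesis by simp
  qed
  show "w k = w' k" for k
    using eq[of k] eq[of "k+1"] zeros_step0[OF assms(1), of k] zeros_step0[OF assms(2), of k]
      zeros_step1[of w k] zeros_step1[of w' k] maya_01[OF assms(1), of k] maya_01[OF assms(2), of k]
    by auto
qed

lemma finite_diagram:
  assumes "maya w"
  shows "finite (diagram w)"
proof -
  obtain l u where lu: "l < u" "\<And>k. k < l \<Longrightarrow> w k = 0" "\<And>k. k \<ge> u \<Longrightarrow> w k = 1"
    using maya_bounds[OF assms] by metis
  have "a \<le> zeros w l \<and> b \<le> ones w u" if "1 \<le> a" "1 \<le> b" "a \<le> zeros w k" "b \<le> ones w k" for a b k
  proof -
    have "l < k" using that(2,4) ones_eq_0[of k w] lu(2) by force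
    moreover have "k < u" using that(1,3) zeros_eq_0[of k w] lu(3) by force
    ultimately show ?thesis
      using that zeros_antimono[OF assms, of l k] ones_mono[OF assms, of k u] by force
  qed
  then have "diagram w \<subseteq> {..zeros w l} \<times> {..ones w u}" by (fastforce simp: diagram_def)
  then show ?thesis by (rule finite_subset) simp
qed

section \<open>Partitions as finite down-closed sets of boxes\<close>

definition down_closed :: "(nat \<times> nat) set \<Rightarrow> bool" where
  "down_closed D \<longleftrightarrow> (\<forall>(a, b)\<in>D. 1 \<le> a \<and> 1 \<le> b \<and>
     (\<forall>a' b'. 1 \<le> a' \<longrightarrow> a' \<le> a \<longrightarrow> 1 \<le> b' \<longrightarrow> b' \<le> b \<longrightarrow> (a', b') \<in> D))"

lemma down_closed_pos: "down_closed D \<Longrightarrow> (a, b) \<in> D \<Longrightarrow> 1 \<le> a \<and> 1 \<le> b"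
  by (auto simp: down_closed_def)

lemma down_closedD:
  "down_closed D \<Longrightarrow> (a, b) \<in> D \<Longrightarrow> 1 \<le> a' \<Longrightarrow> a' \<le> a \<Longrightarrow> 1 \<le> b' \<Longrightarrow> b' \<le> b \<Longrightarrow> (a', b') \<in> D"
  by (fastforce simp: down_closed_def)

lemma down_closed_diagram: "down_closed (diagram w)"
  by (auto simp: down_closed_def diagram_def intro: le_trans)

lemma initial_segment_card:
  assumes "finite A" "0 \<notin> A" "\<And>x y. x \<in> A \<Longrightarrow> 1 \<le> y \<Longrightarrow> y \<le> x \<Longrightarrow> y \<in> A"
  shows "A = {1..card (A::nat set)}"
proof (cases "A = {}")
  case False
  then have "A = {1..Max A}"
    using assms(2,3) Max_in[OF assms(1)] Max_ge[OF assms(1)]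
    by (auto simp: Suc_le_eq intro: gr0I)
  then show ?thesis by (metis card_atLeastAtMost diff_Suc_1 One_nat_def)
qed simp

lemma partition_nth_antimono:
  assumes "is_partition p" "1 \<le> i" "i \<le> i'" "i' \<le> length p"
  shows "p ! (i' - 1) \<le> p ! (i - 1)"
proof (cases "i = i'")
  case False
  then have "i - 1 < i' - 1" "i' - 1 < length p" using assms by auto
  then show ?thesis using assms(1) by (auto simp: is_partition_def sorted_wrt_iff_nth_less)
qed simp

lemma down_closed_young_diagram: "is_partition p \<Longrightarrow> down_closed (young_diagram p)"
  unfolding down_closed_def young_diagram_def
  using partition_nth_antimono by (fastforce intro: order.trans)

lemma finite_young_diagram: "finite (young_diagram p)"
proof -
  have "young_diagram p = (\<Union>i\<in>{1..length p}. {i} \<times> {1..p ! (i - 1)})"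
    by (auto simp: young_diagram_def)
  then show ?thesis by simp
qed

text \<open>By down-closure each row and the first column are initial segments of the positive
  integers, so their sizes describe them completely.\<close>

lemma partition_of_down_closed:
  assumes "finite D" "down_closed D"
  shows "\<exists>p. is_partition p \<and> young_diagram p = D"
proof -
  define row where "row a = {b. (a, b) \<in> D}" for a
  define n where "n = card {a. (a, 1) \<in> D}"
  define p where "p = map (\<lambda>a. card (row (Suc a))) [0..<n]"
  have fin: "finite (row a)" for a
    unfolding row_def by (rule finite_subset[OF _ finite_imageI[OF assms(1), of snd]]) force
  have fin1: "finite {a. (a, 1) \<in> D}"
    by (rule finite_subset[OF _ finite_imageI[OF assms(1), of fst]]) force
  have col: "{a. (a, 1) \<in> D} = {1..n}"
    unfolding n_def
  proof (rule initial_segment_card[OF fin1])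
    show "y \<in> {a. (a, 1) \<in> D}" if "x \<in> {a. (a, 1) \<in> D}" "1 \<le> y" "y \<le> x" for x y
      using down_closedD[OF assms(2), of x 1 y 1] that by simp
  qed (use down_closed_pos[OF assms(2), of 0 1] in auto)
  have row: "row a = {1..card (row a)}" for a
  proof (rule initial_segment_card[OF fin])
    show "y \<in> row a" if "x \<in> row a" "1 \<le> y" "y \<le> x" for x y
      using down_closedD[OF assms(2), of a x a y] down_closed_pos[OF assms(2), of a x] that
      by (simp add: row_def)
  qed (use down_closed_pos[OF assms(2), of a 0] in \<open>auto simp: row_def\<close>)
  have D: "(a, b) \<in> D \<longleftrightarrow> 1 \<le> b \<and> b \<le> card (row a)" for a b
    using row[of a] by (metis atLeastAtMost_iff mem_Collect_eq row_def)
  have dec: "card (row a') \<le> card (row a)" if "1 \<le> a" "a \<le> a'" for a a'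
  proof (rule card_mono[OF fin], rule subsetI)
    show "b \<in> row a" if "b \<in> row a'" for b
      using down_closedD[OF assms(2), of a' b a b] down_closed_pos[OF assms(2), of a' b] that
        \<open>1 \<le> a\<close> \<open>a \<le> a'\<close> by (simp add: row_def)
  qed
  have pos: "1 \<le> a \<and> a \<le> n \<longleftrightarrow> 1 \<le> card (row a)" for a
    using col D[of a 1] by (metis atLeastAtMost_iff mem_Collect_eq order_refl)
  have "is_partition p"
    unfolding is_partition_def
  proof
    show "sorted_wrt (\<ge>) p"
      by (auto simp: p_def sorted_wrt_iff_nth_less intro!: dec)
    have "0 < card (row (Suc a))" if "a < n" for a
      using pos[of "Suc a"] that by linarith
    then show "\<forall>x\<in>set p. 0 < x" by (auto simp: p_def)
  qed
  moreover have "young_diagram p = D"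
  proof (rule set_eqI, clarify)
    fix a b
    show "(a, b) \<in> young_diagram p \<longleftrightarrow> (a, b) \<in> D"
      using D[of a b] pos[of a] by (auto simp: young_diagram_def p_def)
  qed
  ultimately show ?thesis by blast
qed

lemma young_diagram_inj:
  assumes "is_partition p" "is_partition p'" "young_diagram p = young_diagram p'"
  shows "p = p'"
proof (rule nth_equalityI)
  have len: "{a. (a, 1) \<in> young_diagram r} = {1..length r}" if "is_partition r" for r
  proof -
    have "1 \<le> r ! (a - 1)" if "1 \<le> a" "a \<le> length r" for a
      using \<open>is_partition r\<close> that by (auto simp: is_partition_def Suc_le_eq)
    then show ?thesis by (auto simp: young_diagram_def)
  qed
  have "{1..length p} = {1..length p'}"
    using len[OF assms(1)] len[OF assms(2)] assms(3) by simp
  then show l: "length p = length p'" by (metis card_atLeastAtMost diff_Suc_1 One_nat_def)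
  fix i assume i: "i < length p"
  have "{b. (Suc i, b) \<in> young_diagram p} = {1..p ! i}" "{b. (Suc i, b) \<in> young_diagram p'} = {1..p' ! i}"
    using i l by (auto simp: young_diagram_def)
  with assms(3) have "{1..p ! i} = {1..p' ! i}" by metis
  then show "p ! i = p' ! i" by (metis card_atLeastAtMost diff_Suc_1 One_nat_def)
qed

text \<open>A box of \<open>D\<close> can move down its diagonal until the next step leaves
  \<open>D\<close>; there it is a boundary point. So the boundary points determine
  \<open>D\<close>.\<close>

lemma down_closed_eq_boundary:
  assumes "finite D" "down_closed D"
  shows "(a, b) \<in> D \<longleftrightarrow> 1 \<le> a \<and> 1 \<le> b \<and> (\<exists>a' b'. a \<le> a' \<and> b \<le> b' \<and> is_boundary D (a', b'))"
proof
  assume ab: "(a, b) \<in> D"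
  define m where "m = Max {m. (a + m, b + m) \<in> D}"
  have "{m. (a + m, b + m) \<in> D} \<subseteq> (\<lambda>x. fst x - a) ` D" by force
  then have fin: "finite {m. (a + m, b + m) \<in> D}" using assms(1) finite_surj by blast
  have "m \<in> {m. (a + m, b + m) \<in> D}" unfolding m_def
    by (rule Max_in[OF fin]) (use ab in \<open>auto intro: exI[of _ 0]\<close>)
  moreover have "Suc m \<notin> {m. (a + m, b + m) \<in> D}"
    using Max_ge[OF fin, of "Suc m"] unfolding m_def[symmetric] by fastforce
  ultimately have "is_boundary D (a + m, b + m)" by (auto simp: is_boundary_def)
  then show "1 \<le> a \<and> 1 \<le> b \<and> (\<exists>a' b'. a \<le> a' \<and> b \<le> b' \<and> is_boundary D (a', b'))"
    using down_closed_pos[OF assms(2) ab] le_add1 by blast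
next
  assume "1 \<le> a \<and> 1 \<le> b \<and> (\<exists>a' b'. a \<le> a' \<and> b \<le> b' \<and> is_boundary D (a', b'))"
  then show "(a, b) \<in> D" using down_closedD[OF assms(2)] by (fastforce simp: is_boundary_def)
qed

lemma down_closed_boundary_inj:
  assumes "finite D" "down_closed D" "finite D'" "down_closed D'" "\<And>c. is_boundary D c \<longleftrightarrow> is_boundary D' c"
  shows "D = D'"
  using down_closed_eq_boundary[OF assms(1,2)] down_closed_eq_boundary[OF assms(3,4)] assms(5)
  by auto

section \<open>Boundary words of partitions\<close>

lemma boundary_points_eq: "boundary_points p = Collect (is_boundary (young_diagram p))"
  by (auto simp: boundary_points_def is_boundary_def)

lemma boundary_wordI:
  assumes "maya w" "young_diagram p = diagram w"
  shows "boundary_word p w"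
  unfolding boundary_word_def
proof (intro exI[of _ "\<lambda>k. (zeros w k, ones w k)"] conjI allI)
  show "range (\<lambda>k. (zeros w k, ones w k)) = boundary_points p"
    using is_boundary_diagram_iff[OF assms(1)] by (auto simp: boundary_points_eq assms(2))
  fix k
  show "w k = 0 \<and> fst (zeros w k, ones w k) = fst (zeros w (k + 1), ones w (k + 1)) + 1 \<and>
         snd (zeros w k, ones w k) = snd (zeros w (k + 1), ones w (k + 1)) \<or>
       w k = 1 \<and> fst (zeros w (k + 1), ones w (k + 1)) = fst (zeros w k, ones w k) \<and>
         snd (zeros w (k + 1), ones w (k + 1)) = snd (zeros w k, ones w k) + 1"
    using maya_01[OF assms(1), of k] zeros_step0[OF assms(1), of k] zeros_step1[of w k]
      ones_step0[of w k] ones_step1[OF assms(1), of k] by auto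
qed

lemma boundary_wordD:
  assumes "is_partition p" "boundary_word p w"
  shows "maya w" "young_diagram p = diagram w"
proof -
  obtain v :: "int \<Rightarrow> nat \<times> nat" where v: "range v = boundary_points p"
    and st: "\<And>k. w k = 0 \<and> fst (v k) = fst (v (k + 1)) + 1 \<and> snd (v k) = snd (v (k + 1)) \<or>
          w k = 1 \<and> fst (v (k + 1)) = fst (v k) \<and> snd (v (k + 1)) = snd (v k) + 1"
    using assms(2) by (auto simp: boundary_word_def)
  have dec: "fst (v l) \<le> fst (v k)" if "k \<le> l" for k l
    using that
  proof (induction l rule: int_ge_induct)
    case (step i)
    then show ?case using st[of i] by linarith
  qed simp
  have inc: "snd (v k) \<le> snd (v l)" if "k \<le> l" for k l
    using that
  proof (induction l rule: int_ge_induct)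
    case (step i)
    then show ?case using st[of i] by linarith
  qed simp
  \<comment> \<open>\<open>N\<close> exceeds all coordinates of boxes, so \<open>(0, N)\<close> and
    \<open>(N, 0)\<close> lie on the two rays. By monotonicity the path keeps row coordinate
    \<open>0\<close> after the first point and column coordinate \<open>0\<close> before the second.
    This makes the word constant at both ends and anchors the two inductions below.\<close>
  define N where "N = Suc (Max (insert 0 (fst ` young_diagram p \<union> snd ` young_diagram p)))"
  have N: "(a, b) \<in> young_diagram p \<Longrightarrow> a < N \<and> b < N" for a b
    unfolding N_def less_Suc_eq_le
    by (intro conjI Max_ge) (auto simp: finite_young_diagram image_iff intro: bexI[rotated])
  have "(0, N) \<in> range v" "(N, 0) \<in> range v"
    unfolding v using N by (fastforce simp: boundary_points_def)+
  then obtain u l where u: "v u = (0, N)" and l: "v l = (N, 0)" by (metis rangeE)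
  have hi: "w k = 1" if "k \<ge> u" for k
    using st[of k] dec[of u k] that u by auto
  have lo: "w k = 0" if "k < l" for k
    using st[of k] inc[of "k+1" l] that l by auto
  show m: "maya w" unfolding maya_def using st hi lo by metis
  have zu: "zeros w u = 0" using hi by (rule zeros_eq_0)
  have ol: "ones w l = 0" using lo by (rule ones_eq_0)
  have "fst (v k) = zeros w k" for k
  proof (induction k rule: int_induct[of _ u])
    case (step1 i)
    then show ?case using st[of i] zeros_step0[OF m, of i] zeros_step1[of w i] by force
  next
    case (step2 i)
    then show ?case using st[of "i-1"] zeros_step0[OF m, of "i-1"] zeros_step1[of w "i-1"] by force
  qed (use zu u in simp)
  moreover have "snd (v k) = ones w k" for k
  proof (induction k rule: int_induct[of _ l])
    case (step1 i)
    then show ?case using st[of i] ones_step1[OF m, of i] ones_step0[of w i] by force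
  next
    case (step2 i)
    then show ?case using st[of "i-1"] ones_step1[OF m, of "i-1"] ones_step0[of w "i-1"] by force
  qed (use ol l in simp)
  ultimately have vk: "v k = (zeros w k, ones w k)" for k by (metis prod.collapse)
  have "is_boundary (young_diagram p) c \<longleftrightarrow> is_boundary (diagram w) c" for c
  proof -
    have "is_boundary (young_diagram p) c \<longleftrightarrow> c \<in> range v" by (simp add: v boundary_points_eq)
    also have "\<dots> \<longleftrightarrow> is_boundary (diagram w) c"
      using is_boundary_diagram_iff[OF m, of "fst c" "snd c"] by (auto simp: vk image_iff prod_eq_iff)
    finally show ?thesis .
  qed
  then show "young_diagram p = diagram w"
    by (intro down_closed_boundary_inj finite_young_diagram down_closed_young_diagram
        assms(1) finite_diagram m down_closed_diagram)
qed

lemma boundary_word_iff: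
  "is_partition p \<Longrightarrow> boundary_word p w \<longleftrightarrow> maya w \<and> young_diagram p = diagram w"
  using boundary_wordI boundary_wordD by metis

lemma ex_balanced_word:
  assumes "is_partition p"
  shows "\<exists>w. maya w \<and> young_diagram p = diagram w \<and> charge w = 0"
proof -
  define row where "row a = (if a - 1 < length p then p ! (a - 1) else 0)" for a
  \<comment> \<open>The index of the vertical edge closing row \<open>a\<close> in the balanced
    word; these numbers form the beta-set of the partition. As \<open>row\<close> is
    \<open>0\<close> beyond the last row, the infinite vertical ray is included.\<close>
  define s where "s a = int (row a) - int a" for a
  define w where "w d = (if \<exists>a\<ge>1. s a = d then 0 else 1::nat)" for d
  have row: "row a' \<le> row a" if "1 \<le> a" "a \<le> a'" for a a'
    using partition_nth_antimono[OF assms, of a a'] that by (auto simp: row_def)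
  have s: "s a' < s a \<longleftrightarrow> a < a'" if "1 \<le> a" "1 \<le> a'" for a a'
    using row[of a a'] row[of a' a] that unfolding s_def by linarith
  have s_inj: "inj_on s {1..}"
    using s by (intro inj_onI) (metis atLeast_iff nat_neq_iff order_less_irrefl)
  have yd: "(a, b) \<in> young_diagram p \<longleftrightarrow> 1 \<le> a \<and> 1 \<le> b \<and> b \<le> row a" for a b
    by (auto simp: young_diagram_def row_def)
  define N where "N = length p"
  have beyond: "row a = 0" if "a > N" for a using that by (auto simp: row_def N_def)
  have lo: "w d = 0" if "d < - int N" for d
  proof -
    have "s (nat (- d)) = d" using beyond[of "nat (-d)"] that by (simp add: s_def)
    then show ?thesis using that by (auto simp: w_def intro!: exI[of _ "nat (-d)"])
  qed
  have hi: "w d = 1" if "d \<ge> int (row 1)" for d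
    using row[of 1] that by (force simp: w_def s_def)
  have m: "maya w" unfolding maya_def
  proof (intro conjI exI)
    show "\<forall>k. w k = 0 \<or> w k = 1" by (simp add: w_def)
  qed (use lo hi in blast)+
  have z: "zeros w d = card {a. 1 \<le> a \<and> d \<le> s a}" for d
  proof -
    have "{j. d \<le> j \<and> w j = 0} = s ` {a. 1 \<le> a \<and> d \<le> s a}" by (auto simp: w_def)
    moreover have "inj_on s {a. 1 \<le> a \<and> d \<le> s a}" by (rule inj_on_subset[OF s_inj]) auto
    ultimately show ?thesis by (simp add: zeros_def card_image)
  qed
  \<comment> \<open>Position \<open>- N\<close> is the lower left vertex of the diagram. Both counts
    are known there, so the charge can be read off.\<close>
  have "{a. 1 \<le> a \<and> - int N \<le> s a} = {1..N}"
    using beyond by (auto simp: s_def) (metis not_le of_nat_0 diff_0 neg_le_iff_le of_nat_le_iff)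
  then have "zeros w (- int N) = N" by (simp add: z)
  moreover have "ones w (- int N) = 0" using lo by (rule ones_eq_0)
  ultimately have c: "charge w = 0" using ones_minus_zeros[OF m, of "- int N"] by simp
  have "(a, b) \<in> young_diagram p \<longleftrightarrow> (a, b) \<in> diagram w" for a b
  proof (cases "1 \<le> a")
    case True
    have "{a'. 1 \<le> a' \<and> s a \<le> s a'} = {1..a}"
    proof -
      have "s a \<le> s a' \<longleftrightarrow> a' \<le> a" if "1 \<le> a'" for a'
        using s[OF True that] by linarith
      then show ?thesis by auto
    qed
    then have za: "zeros w (s a) = a" by (simp add: z)
    moreover have "ones w (s a) = row a"
      using ones_minus_zeros[OF m, of "s a"] c za by (simp add: s_def)
    moreover have "w (s a) = 0" using True by (auto simp: w_def)
    ultimately show ?thesis using diagram_row[OF m, of "s a" b] yd True by auto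
  qed (use yd in \<open>auto simp: diagram_def\<close>)
  then have "young_diagram p = diagram w" by auto
  with m c show ?thesis by blast
qed

lemma zero_one_seq:
  assumes "is_partition p"
  shows "maya (zero_one_seq p)" "diagram (zero_one_seq p) = young_diagram p"
    "charge (zero_one_seq p) = 0"
proof -
  let ?P = "\<lambda>z. boundary_word p z \<and> card {i. 0 \<le> i \<and> z i = 0} = card {i. i < 0 \<and> z i = 1}"
  have P: "?P z \<longleftrightarrow> maya z \<and> young_diagram p = diagram z \<and> charge z = 0" for z
    by (auto simp: boundary_word_iff[OF assms] charge_def zeros_def ones_def)
  have "\<exists>!z. ?P z"
    unfolding P using ex_balanced_word[OF assms] diagram_inj by metis
  then have "?P (zero_one_seq p)" unfolding zero_one_seq_def by (rule theI')
  then show "maya (zero_one_seq p)" "diagram (zero_one_seq p) = young_diagram p"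
    "charge (zero_one_seq p) = 0" unfolding P by auto
qed

lemma zero_one_seq_unique:
  assumes "is_partition p" "maya w" "diagram w = young_diagram p" "charge w = 0"
  shows "zero_one_seq p = w"
  using diagram_inj[OF zero_one_seq(1)[OF assms(1)] assms(2)] zero_one_seq[OF assms(1)] assms
  by simp

section \<open>Words of the quotients\<close>

definition quot_word :: "nat \<Rightarrow> (int \<Rightarrow> nat) \<Rightarrow> nat \<Rightarrow> int \<Rightarrow> nat" where
  "quot_word t w i = (\<lambda>j. w (int t * j + int i))"

lemma maya_quot_word:
  assumes "maya w" "t > 0"
  shows "maya (quot_word t w i)"
proof -
  obtain l u where lu: "\<And>k. k < l \<Longrightarrow> w k = 0" "\<And>k. k \<ge> u \<Longrightarrow> w k = 1" "l \<le> 0" "0 \<le> u"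
    using maya_bounds[OF assms(1), of 0 0] by metis
  have *: "k \<le> int t * k" if "0 \<le> k" for k
    using mult_right_mono[of 1 "int t" k] that assms(2) by simp
  have "quot_word t w i k = 0" if "k < l - int i" for k
  proof -
    have "int t * k \<le> k" using *[of "-k"] that lu(3) by simp
    with that show ?thesis unfolding quot_word_def by (intro lu(1)) linarith
  qed
  moreover have "quot_word t w i k = 1" if "k \<ge> u" for k
    using *[of "k"] that lu(4) unfolding quot_word_def by (intro lu(2)) linarith
  ultimately show ?thesis using maya_01[OF assms(1)] by (auto simp: maya_def quot_word_def)
qed

lemma t_quotient:
  assumes "is_partition p" "t > 0"
  shows "is_partition (t_quotient t p i)"
    "young_diagram (t_quotient t p i) = diagram (quot_word t (zero_one_seq p) i)"
proof -
  let ?w = "quot_word t (zero_one_seq p) i"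
  let ?P = "\<lambda>p'. is_partition p' \<and> boundary_word p' ?w"
  have m: "maya ?w" using zero_one_seq(1)[OF assms(1)] assms(2) by (rule maya_quot_word)
  have "\<exists>!p'. ?P p'"
    using partition_of_down_closed[OF finite_diagram[OF m] down_closed_diagram]
      young_diagram_inj m boundary_word_iff by metis
  then have "?P (t_quotient t p i)"
    unfolding t_quotient_def quot_word_def by (rule theI')
  then show "is_partition (t_quotient t p i)" "young_diagram (t_quotient t p i) = diagram ?w"
    using boundary_word_iff by blast+
qed

subsection \<open>Corners\<close>

text \<open>Vertex \<open>k\<close> lies between the edges \<open>k - 1\<close> and
  \<open>k\<close>. A vertical edge followed by a horizontal one is a place where a box fits, and
  its content is one of the x's. In the same way \<open>outer\<close> collects the lower right
  vertices of the removable boxes, which give the y's.\<close>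

definition inner :: "(int \<Rightarrow> nat) \<Rightarrow> int set" where
  "inner w = {k. w (k - 1) = 0 \<and> w k = 1}"

definition outer :: "(int \<Rightarrow> nat) \<Rightarrow> int set" where
  "outer w = {k. w (k - 1) = 1 \<and> w k = 0}"

definition q_word :: "nat \<Rightarrow> (int \<Rightarrow> nat) \<Rightarrow> int" where
  "q_word k w = (\<Sum>m\<in>inner w. (m - charge w) ^ k) - (\<Sum>m\<in>outer w. (m - charge w) ^ k)"

lemma inner_outer_bounds:
  assumes "\<And>k. k < l \<Longrightarrow> w k = 0" "\<And>k. k \<ge> u \<Longrightarrow> w k = 1"
  shows "inner w \<subseteq> {l..u}" "outer w \<subseteq> {l<..<u}"
proof -
  show "inner w \<subseteq> {l..u}"
  proof
    fix k assume k: "k \<in> inner w"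
    have "\<not> k < l" using assms(1)[of k] k by (auto simp: inner_def)
    moreover have "\<not> k - 1 \<ge> u" using assms(2)[of "k-1"] k by (auto simp: inner_def)
    ultimately show "k \<in> {l..u}" by auto
  qed
  show "outer w \<subseteq> {l<..<u}"
  proof
    fix k assume k: "k \<in> outer w"
    have "\<not> k \<le> l" using assms(1)[of "k-1"] k by (auto simp: outer_def)
    moreover have "\<not> k \<ge> u" using assms(2)[of k] k by (auto simp: outer_def)
    ultimately show "k \<in> {l<..<u}" by auto
  qed
qed

lemma finite_inner_outer:
  assumes "maya w"
  shows "finite (inner w)" "finite (outer w)"
proof -
  obtain l u where lu: "\<And>k. k < l \<Longrightarrow> w k = 0" "\<And>k. k \<ge> u \<Longrightarrow> w k = 1"
    using maya_bounds[OF assms, of 0 0] by metis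
  show "finite (inner w)" "finite (outer w)"
    using inner_outer_bounds[OF lu] by (meson finite_atLeastAtMost_int finite_greaterThanLessThan_int finite_subset)+
qed

text \<open>The jump \<open>w m - w (m - 1)\<close> is \<open>1\<close> at inner corners,
  \<open>-1\<close> at outer corners and \<open>0\<close> elsewhere. The sum on the right may range
  over any finite set containing the corners, so words with different corners can be compared term
  by term.\<close>

lemma sum_jumps:
  fixes f :: "int \<Rightarrow> int"
  assumes "maya w" "finite S" "inner w \<subseteq> S" "outer w \<subseteq> S"
  shows "(\<Sum>m\<in>inner w. f m) - (\<Sum>m\<in>outer w. f m) = (\<Sum>m\<in>S. (int (w m) - int (w (m - 1))) * f m)"
proof -
  have "(\<Sum>m\<in>inner w. f m) - (\<Sum>m\<in>outer w. f m) =
      (\<Sum>m\<in>S. if m \<in> inner w then f m else 0) - (\<Sum>m\<in>S. if m \<in> outer w then f m else 0)"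
    using assms(2-4) by (simp add: sum.inter_restrict[symmetric] Int_absorb1)
  also have "\<dots> = (\<Sum>m\<in>S. (int (w m) - int (w (m - 1))) * f m)"
    unfolding sum_subtractf[symmetric]
  proof (rule sum.cong[OF refl])
    show "(if m \<in> inner w then f m else 0) - (if m \<in> outer w then f m else 0) =
         (int (w m) - int (w (m - 1))) * f m" for m
      using maya_01[OF assms(1), of m] maya_01[OF assms(1), of "m-1"]
      by (auto simp: inner_def outer_def)
  qed
  finally show ?thesis .
qed

lemma sum_telescope_int:
  fixes g :: "int \<Rightarrow> int"
  assumes "l \<le> u"
  shows "(\<Sum>m\<in>{l..u}. g m - g (m - 1)) = g u - g (l - 1)"
  using assms
proof (induction u rule: int_ge_induct)
  case (step u)
  have "{l..u + 1} = insert (u + 1) {l..u}" using step by auto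
  then show ?case using step by simp
qed simp

text \<open>The jumps of \<open>w\<close> telescope, from \<open>0\<close> far to the left to
  \<open>1\<close> far to the right.\<close>

lemma card_inner:
  assumes "maya w"
  shows "card (inner w) = Suc (card (outer w))"
proof -
  obtain l u where lu: "l < u" "\<And>k. k < l \<Longrightarrow> w k = 0" "\<And>k. k \<ge> u \<Longrightarrow> w k = 1"
    using maya_bounds[OF assms, of 0 0] by metis
  have sub: "inner w \<subseteq> {l..u}" "outer w \<subseteq> {l..u}"
    using inner_outer_bounds[OF lu(2,3)] by fastforce+
  have "int (card (inner w)) - int (card (outer w)) =
      (\<Sum>m\<in>inner w. 1) - (\<Sum>m\<in>outer w. 1)" by simp
  also have "\<dots> = (\<Sum>m\<in>{l..u}. (int (w m) - int (w (m - 1))) * 1)"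
    by (rule sum_jumps) (use assms sub in auto)
  also have "\<dots> = 1" using sum_telescope_int[of l u "\<lambda>m. int (w m)"] lu by simp
  finally show ?thesis by simp
qed

section \<open>Corners of a partition as factors of its word\<close>

lemma down_closedI:
  assumes "\<And>a b. (a, b) \<in> D \<Longrightarrow> 1 \<le> a \<and> 1 \<le> b"
    "\<And>a b a' b'. (a, b) \<in> D \<Longrightarrow> 1 \<le> a' \<Longrightarrow> a' \<le> a \<Longrightarrow> 1 \<le> b' \<Longrightarrow> b' \<le> b \<Longrightarrow> (a', b') \<in> D"
  shows "down_closed D"
  unfolding down_closed_def by (auto dest: assms(1) intro: assms(2))

text \<open>Removability, defined through the existence of another partition, becomes a condition on
  two neighbouring boxes: any further box weakly below and to the right would force one of these two
  into the diagram.\<close>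

lemma outer_corners_iff:
  assumes "is_partition p"
  shows "(a, b) \<in> outer_corners p \<longleftrightarrow> (a, b) \<in> young_diagram p \<and>
     (a + 1, b) \<notin> young_diagram p \<and> (a, b + 1) \<notin> young_diagram p"
    (is "?L \<longleftrightarrow> ?R")
proof
  let ?D = "young_diagram p"
  assume ?L
  then obtain p' where p': "is_partition p'" "young_diagram p' = ?D - {(a, b)}" "(a, b) \<in> ?D"
    by (auto simp: outer_corners_def)
  note dc = down_closed_young_diagram[OF p'(1), unfolded p'(2)]
  have "1 \<le> a" "1 \<le> b"
    using down_closed_pos[OF down_closed_young_diagram[OF assms] p'(3)] by auto
  then show ?R
    using p'(3) down_closedD[OF dc, of "a+1" b a b] down_closedD[OF dc, of a "b+1" a b] by auto
next
  let ?D = "young_diagram p"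
  assume R: ?R
  note dc = down_closed_young_diagram[OF assms]
  have ab: "1 \<le> a" "1 \<le> b" using down_closed_pos[OF dc] R by auto
  have "down_closed (?D - {(a, b)})"
  proof (rule down_closedI)
    show "1 \<le> a1 \<and> 1 \<le> b1" if "(a1, b1) \<in> ?D - {(a, b)}" for a1 b1
      using down_closed_pos[OF dc] that by auto
    fix a1 b1 a' b' assume "(a1, b1) \<in> ?D - {(a, b)}"
      and 2: "1 \<le> a'" "a' \<le> a1" "1 \<le> b'" "b' \<le> b1"
    then have 1: "(a1, b1) \<in> ?D" "(a1, b1) \<noteq> (a, b)" by auto
    have "(a', b') \<noteq> (a, b)"
    proof
      assume "(a', b') = (a, b)"
      then have "a + 1 \<le> a1 \<and> b \<le> b1 \<or> a \<le> a1 \<and> b + 1 \<le> b1" using 1 2 by auto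
      then show False using R 1(1) ab down_closedD[OF dc, of a1 b1] by force
    qed
    then show "(a', b') \<in> ?D - {(a, b)}" using down_closedD[OF dc 1(1) 2] by simp
  qed
  then obtain p' where "is_partition p'" "young_diagram p' = ?D - {(a, b)}"
    using partition_of_down_closed[of "?D - {(a, b)}"] finite_young_diagram by blast
  with R show ?L by (auto simp: outer_corners_def)
qed

lemma outer_corners_word:
  assumes "is_partition p" "maya w" "young_diagram p = diagram w"
  shows "outer_corners p = (\<lambda>k. (zeros w k, ones w k)) ` outer w"
proof (rule set_eqI, clarify)
  fix a b
  show "(a, b) \<in> outer_corners p \<longleftrightarrow> (a, b) \<in> (\<lambda>k. (zeros w k, ones w k)) ` outer w"
    unfolding outer_corners_iff[OF assms(1)] assms(3)
  proof
    assume R: "(a, b) \<in> diagram w \<and> (a + 1, b) \<notin> diagram w \<and> (a, b + 1) \<notin> diagram w"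
    then have "(a + 1, b + 1) \<notin> diagram w"
      using down_closedD[OF down_closed_diagram, of "a+1" "b+1" w a "b+1"] by (auto simp: diagram_def)
    with R have "is_boundary (diagram w) (a, b)" by (simp add: is_boundary_def)
    then obtain k where k: "a = zeros w k" "b = ones w k"
      using is_boundary_diagram_iff[OF assms(2)] by blast
    have ab: "1 \<le> a" "1 \<le> b" using R by (auto simp: diagram_def)
    have "w k \<noteq> 1"
    proof
      assume "w k = 1"
      then have "zeros w (k+1) = a" "ones w (k+1) = b + 1"
        using k zeros_step1[of w k] ones_step1[OF assms(2), of k] by auto
      with ab have "(a, b + 1) \<in> diagram w" by (auto simp: diagram_def intro!: exI[of _ "k+1"])
      with R show False by simp
    qed
    moreover have "w (k - 1) \<noteq> 0"
    proof
      assume "w (k - 1) = 0"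
      then have "zeros w (k-1) = a + 1" "ones w (k-1) = b"
        using k zeros_step0[OF assms(2), of "k-1"] ones_step0[of w "k-1"] by auto
      with ab have "(a + 1, b) \<in> diagram w" by (auto simp: diagram_def intro!: exI[of _ "k-1"])
      with R show False by simp
    qed
    ultimately have "k \<in> outer w"
      using maya_01[OF assms(2), of k] maya_01[OF assms(2), of "k-1"] by (auto simp: outer_def)
    with k show "(a, b) \<in> (\<lambda>k. (zeros w k, ones w k)) ` outer w" by blast
  next
    assume "(a, b) \<in> (\<lambda>k. (zeros w k, ones w k)) ` outer w"
    then obtain k where k: "a = zeros w k" "b = ones w k" "w (k - 1) = 1" "w k = 0"
      by (auto simp: outer_def)
    have r: "(a, b') \<in> diagram w \<longleftrightarrow> 1 \<le> b' \<and> b' \<le> b" for b'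
      using diagram_row[OF assms(2) k(4)] k by simp
    have "Suc (ones w (k - 1)) = b" "zeros w (k - 1) = a"
      using ones_step1[OF assms(2) k(3)] zeros_step1[of w "k-1"] k by auto
    then have c: "(a', b) \<in> diagram w \<longleftrightarrow> 1 \<le> a' \<and> a' \<le> a" and "1 \<le> b" for a'
      using diagram_col[OF assms(2) k(3)] by auto
    with r show "(a, b) \<in> diagram w \<and> (a + 1, b) \<notin> diagram w \<and> (a, b + 1) \<notin> diagram w"
      by auto
  qed
qed

lemma (in linorder) sorted_key_list_of_set_eqI:
  assumes "inj_on f (set xs)" "sorted (map f xs)" "distinct xs"
  shows "sorted_key_list_of_set f (set xs) = xs"
proof -
  interpret folding_insort_key less_eq less "set xs" f by unfold_locales (rule assms)
  show ?thesis using assms by (intro idem_if_sorted_distinct) auto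
qed

text \<open>Rows decrease along the boundary, so decreasing order of rows is increasing order of
  positions. No two corners share a row because different zeros close different rows.\<close>

lemma corner_list_word:
  assumes "is_partition p" "maya w" "young_diagram p = diagram w"
  shows "corner_list p = map (\<lambda>k. (zeros w k, ones w k)) (sorted_list_of_set (outer w))"
proof -
  let ?pt = "\<lambda>k. (zeros w k, ones w k)"
  let ?ys = "sorted_list_of_set (outer w)"
  have inj: "inj_on fst (outer_corners p)"
  proof (rule inj_onI)
    fix c c' assume "c \<in> outer_corners p" "c' \<in> outer_corners p" "fst c = fst c'"
    then obtain k k' where k: "c = (zeros w k, ones w k)" "c' = (zeros w k', ones w k')"
      "w k = 0" "w k' = 0" "zeros w k = zeros w k'"
      by (auto simp: outer_corners_word[OF assms] outer_def)
    then show "c = c'" using zeros_inj[OF assms(2), of k k'] by simp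
  qed
  have fin: "finite (outer w)" by (rule finite_inner_outer[OF assms(2)])
  have set: "set (map ?pt (rev ?ys)) = outer_corners p"
    using fin by (simp add: outer_corners_word[OF assms])
  have "sorted (map fst (map ?pt (rev ?ys)))"
    unfolding map_map comp_def fst_conv
    by (subst sorted_wrt_rev[symmetric], unfold rev_map rev_rev_ident sorted_wrt_map)
      (rule sorted_wrt_mono_rel[OF _ sorted_sorted_list_of_set], rule zeros_antimono[OF assms(2)])
  moreover have "distinct (map ?pt (rev ?ys))"
    unfolding distinct_map
  proof
    show "inj_on ?pt (set (rev ?ys))"
      using zeros_inj[OF assms(2)] fin by (auto simp: outer_def intro!: inj_onI)
  qed simp
  ultimately have "sorted_key_list_of_set fst (outer_corners p) = map ?pt (rev ?ys)"
    using sorted_key_list_of_set_eqI[of fst "map ?pt (rev ?ys)"] inj unfolding set by simp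
  then show ?thesis by (simp add: corner_list_def rev_map)
qed

text \<open>Without an outer corner in between, the letters from \<open>y\<close> to
  \<open>y' - 1\<close> read 0...01...1. The turning point \<open>x\<close> has the column of
  \<open>y\<close> and the row of \<open>y'\<close>, which is how \<open>x_content\<close> combines
  neighbouring corners.\<close>

lemma ex_inner_between:
  assumes "maya w" "w y = 0" "w (y' - 1) = 1" "y < y'" "\<And>k. y < k \<Longrightarrow> k < y' \<Longrightarrow> k \<notin> outer w"
  obtains x where "x \<in> inner w" "y < x" "x < y'" "ones w x = ones w y" "zeros w x = zeros w y'"
proof -
  define x where "x = Min {k \<in> {y..y' - 1}. w k = 1}"
  have fin: "finite {k \<in> {y..y' - 1}. w k = 1}"
    by (rule finite_subset[of _ "{y..y' - 1}"]) auto
  have "x \<in> {k \<in> {y..y' - 1}. w k = 1}"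
    unfolding x_def by (rule Min_in[OF fin]) (use assms in \<open>auto intro!: exI[of _ "y' - 1"]\<close>)
  then have x: "y \<le> x" "x < y'" "w x = 1" by auto
  with assms(2) have yx: "y < x" by (cases "x = y") auto
  have zero: "w k = 0" if "y \<le> k" "k < x" for k
    using Min_le[OF fin, folded x_def, of k] that x maya_01[OF assms(1), of k] by auto
  have one: "w k = 1" if "x \<le> k" "k < y'" for k
    using that
  proof (induction k rule: int_ge_induct)
    case (step i)
    then have "w (i + 1) \<noteq> 0" using assms(5)[of "i+1"] yx by (auto simp: outer_def)
    then show ?case using maya_01[OF assms(1), of "i+1"] by simp
  qed (rule x)
  have o: "ones w k = ones w y" if "y \<le> k" "k \<le> x" for k
    using that
  proof (induction k rule: int_ge_induct)
    case (step i)
    then show ?case using ones_step0[of w i] zero[of i] by simp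
  qed simp
  have z: "zeros w k = zeros w x" if "x \<le> k" "k \<le> y'" for k
    using that
  proof (induction k rule: int_ge_induct)
    case (step i)
    then show ?case using zeros_step1[of w i] one[of i] by simp
  qed simp
  show ?thesis
    by (rule that[of x]) (use x yx zero[of "x-1"] o[of x] z[of y'] in \<open>auto simp: inner_def\<close>)
qed

lemma q_eq_q_word:
  assumes "is_partition p" "maya w" "young_diagram p = diagram w"
  shows "q k p = of_int (q_word k w)"
proof -
  let ?ys = "sorted_list_of_set (outer w)"
  define m where "m = length ?ys"
  note fin = finite_inner_outer[OF assms(2)]
  obtain l u where lu: "l < u" "\<And>k. k < l \<Longrightarrow> w k = 0" "\<And>k. k \<ge> u \<Longrightarrow> w k = 1"
    using maya_bounds[OF assms(2), of 0 0] by metis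
  note bounds = inner_outer_bounds[OF lu(2,3)]
  \<comment> \<open>The two sentinels realize the conventions for the missing corners: there are no
    ones before \<open>l - 1\<close> and no zeros from \<open>u + 1\<close> on, so these coordinates
    are \<open>0\<close>. The letters at \<open>l - 1\<close> and at \<open>u\<close> are those that
    \<open>ex_inner_between\<close> asks for.\<close>
  define yl where "yl = (l - 1) # ?ys @ [u + 1]"
  have len: "length yl = m + 2" by (simp add: yl_def m_def)
  have sorted: "sorted_wrt (<) yl"
    using bounds(2) fin lu(1) by (fastforce simp: yl_def sorted_wrt_append)
  then have mono: "yl ! i < yl ! j" if "i < j" "j \<le> m + 1" for i j
    using that len by (simp add: sorted_wrt_iff_nth_less)
  have mono_iff: "yl ! i < yl ! j \<longleftrightarrow> i < j" if "i \<le> m + 1" "j \<le> m + 1" for i j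
    using mono[of i j] mono[of j i] that by (metis linorder_neqE_nat order_less_asym order_less_irrefl)
  have cl: "corner_list p = map (\<lambda>k. (zeros w k, ones w k)) ?ys"
    by (rule corner_list_word[OF assms])
  have yl: "yl ! j = ?ys ! (j - 1)" if "1 \<le> j" "j \<le> m" for j
    using that by (cases j) (auto simp: yl_def nth_append m_def)
  have in_outer: "yl ! j \<in> outer w" if "1 \<le> j" "j \<le> m" for j
    using that yl[OF that] nth_mem[of "j - 1" ?ys] fin by (simp add: m_def)
  have outer_nth: "\<exists>j\<in>{1..m}. yl ! j = k" if "k \<in> outer w" for k
  proof -
    have "k \<in> set ?ys" using that fin by simp
    then obtain i where "i < m" "?ys ! i = k" unfolding m_def by (metis in_set_conv_nth)
    then show ?thesis using yl[of "Suc i"] by (intro bexI[of _ "Suc i"]) auto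
  qed
  have yl0: "yl ! 0 = l - 1" and yl_end: "yl ! (m + 1) = u + 1"
    by (simp_all add: yl_def m_def nth_append)
  have col: "corner_col p i = int (ones w (yl ! i))" if "i \<le> m" for i
    using that yl[of i] ones_eq_0[of "l-1" w] lu(2) yl0
    by (cases "i = 0") (auto simp: corner_col_def cl m_def)
  have row: "corner_row p i = int (zeros w (yl ! i))" if "1 \<le> i" "i \<le> m + 1" for i
    using that yl[of i] zeros_eq_0[of "u+1" w] lu(3) yl_end
    by (cases "i = m + 1") (auto simp: corner_row_def cl m_def)
  have "\<exists>x. x \<in> inner w \<and> yl ! i < x \<and> x < yl ! (i + 1) \<and> x_content p i = x - charge w"
    if i: "i \<le> m" for i
  proof -
    have "w (yl ! i) = 0"
      using in_outer[of i] i lu(2) yl0 by (cases "i = 0") (auto simp: outer_def)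
    moreover have "w (yl ! (i + 1) - 1) = 1"
      using in_outer[of "i + 1"] i lu(3) yl_end by (cases "i = m") (auto simp: outer_def)
    moreover have "k \<notin> outer w" if "yl ! i < k" "k < yl ! (i + 1)" for k
      using outer_nth[of k] mono_iff[of i] mono_iff[of _ "i + 1"] that i by fastforce
    ultimately obtain x where x: "x \<in> inner w" "yl ! i < x" "x < yl ! (i + 1)"
      "ones w x = ones w (yl ! i)" "zeros w x = zeros w (yl ! (i + 1))"
      using ex_inner_between[OF assms(2), of "yl ! i" "yl ! (i + 1)"] mono[of i "i+1"] i
      by (metis add_le_cancel_right less_add_one)
    have "x_content p i = int (ones w x) - int (zeros w x)"
      using x col[of i] row[of "i+1"] i by (simp add: x_content_def)
    then show ?thesis using x ones_minus_zeros[OF assms(2), of x] by auto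
  qed
  then obtain g where g: "\<And>i. i \<le> m \<Longrightarrow> g i \<in> inner w \<and> yl ! i < g i \<and> g i < yl ! (i + 1) \<and>
      x_content p i = g i - charge w" by metis
  have "i = j" if ij: "i \<le> m" "j \<le> m" "g i = g j" for i j
    using g[of i] g[of j] ij mono_iff[of i "j+1"] mono_iff[of j "i+1"] by force
  then have inj: "inj_on g {0..m}" by (auto intro: inj_onI)
  \<comment> \<open>Each of the \<open>m + 1\<close> gaps contains an inner corner, and there are
    exactly \<open>m + 1\<close> inner corners, so none is missed.\<close>
  have "card (g ` {0..m}) = card (inner w)"
    using card_image[OF inj] card_inner[OF assms(2)] fin by (simp add: m_def)
  then have img: "g ` {0..m} = inner w"
    using g fin by (intro card_subset_eq) auto
  have "(\<Sum>i = 0..m. x_content p i ^ k) = (\<Sum>i = 0..m. (g i - charge w) ^ k)"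
    by (rule sum.cong) (use g in auto)
  also have "\<dots> = (\<Sum>x\<in>inner w. (x - charge w) ^ k)"
    unfolding img[symmetric] by (simp add: sum.reindex[OF inj])
  finally have X: "(\<Sum>i = 0..m. x_content p i ^ k) = (\<Sum>x\<in>inner w. (x - charge w) ^ k)" .
  have "inj_on ((!) yl) {1..m}"
    by (rule inj_onI) (use mono_iff in \<open>metis atLeastAtMost_iff le_add1 le_trans linorder_neqE_nat order_less_irrefl\<close>)
  moreover have "(!) yl ` {1..m} = outer w"
    using in_outer outer_nth by fastforce
  ultimately have "(\<Sum>y\<in>outer w. (y - charge w) ^ k) = (\<Sum>j = 1..m. (yl ! j - charge w) ^ k)"
    using sum.reindex[of "(!) yl" "{1..m}" "\<lambda>y. (y - charge w) ^ k"] by simp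
  also have "\<dots> = (\<Sum>j = 1..m. y_content p j ^ k)"
    by (rule sum.cong)
      (use col row ones_minus_zeros[OF assms(2)] in \<open>auto simp: y_content_def\<close>)
  finally show ?thesis
    unfolding q_def q_word_def X[symmetric] cl length_map m_def[symmetric] by simp
qed

subsection \<open>Hooks\<close>

definition inversions :: "(int \<Rightarrow> nat) \<Rightarrow> (int \<times> int) set" where
  "inversions w = {(i, j). i < j \<and> w i = 1 \<and> w j = 0}"

text \<open>The column closed by the horizontal edge \<open>i\<close> and the row closed by the
  vertical edge \<open>j\<close> meet in a box of the diagram exactly when \<open>i\<close> comes
  before \<open>j\<close>.\<close>

lemma bij_betw_inversions:
  assumes "maya w"
  shows "bij_betw (\<lambda>(i, j). (zeros w j, Suc (ones w i))) (inversions w) (diagram w)"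
  unfolding bij_betw_def
proof
  show "inj_on (\<lambda>(i, j). (zeros w j, Suc (ones w i))) (inversions w)"
    using zeros_inj[OF assms] ones_inj[OF assms] by (auto simp: inversions_def intro!: inj_onI)
  show "(\<lambda>(i, j). (zeros w j, Suc (ones w i))) ` inversions w = diagram w"
  proof (intro equalityI subsetI)
    fix c assume "c \<in> (\<lambda>(i, j). (zeros w j, Suc (ones w i))) ` inversions w"
    then obtain i j where ij: "c = (zeros w j, Suc (ones w i))" "i < j" "w i = 1" "w j = 0"
      by (auto simp: inversions_def)
    then show "c \<in> diagram w"
      using diagram_row[OF assms ij(4), of "Suc (ones w i)"] ones_lt[OF assms ij(3,2)] by simp
  next
    fix c assume c: "c \<in> diagram w"
    obtain a b where ab: "c = (a, b)" by force
    with c have "1 \<le> a" "1 \<le> b" by (auto simp: diagram_def)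
    then obtain i j where ij: "w j = 0" "zeros w j = a" "w i = 1" "Suc (ones w i) = b"
      using ex_zero_row[OF assms] ex_one_col[OF assms] by metis
    have "b \<le> ones w j" using diagram_row[OF assms ij(1), of b] ij c ab by simp
    then have "i < j" using ones_mono[OF assms, of j i] ij(4) by force
    then show "c \<in> (\<lambda>(i, j). (zeros w j, Suc (ones w i))) ` inversions w"
      using ij ab by (auto simp: inversions_def intro!: image_eqI[of _ _ "(i, j)"])
  qed
qed

lemma finite_inversions: "maya w \<Longrightarrow> finite (inversions w)"
  using bij_betw_finite[OF bij_betw_inversions] finite_diagram by blast

text \<open>The arm counts the ones strictly between \<open>i\<close> and \<open>j\<close>, the leg
  counts the zeros there. Together with the box itself this makes \<open>j - i\<close>.\<close>

lemma hook_length_word: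
  assumes "maya w" "young_diagram p = diagram w" "(i, j) \<in> inversions w"
  shows "hook_length p (zeros w j, Suc (ones w i)) = nat (j - i)"
proof -
  have ij: "i < j" "w i = 1" "w j = 0" using assms(3) by (auto simp: inversions_def)
  have "{b. Suc (ones w i) < b \<and> (zeros w j, b) \<in> diagram w} = {Suc (ones w i)<..ones w j}"
    by (auto simp: diagram_row[OF assms(1) ij(3)])
  moreover have "{a. zeros w j < a \<and> (a, Suc (ones w i)) \<in> diagram w} = {zeros w j<..zeros w i}"
    by (auto simp: diagram_col[OF assms(1) ij(2)])
  ultimately have "int (hook_length p (zeros w j, Suc (ones w i))) =
     int (ones w j) - int (Suc (ones w i)) + (int (zeros w i) - int (zeros w j)) + 1"
    using ones_lt[OF assms(1) ij(2,1)] zeros_antimono[OF assms(1), of i j] ij(1)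
    by (simp add: hook_length_def assms(2) of_nat_diff Suc_le_eq)
  also have "\<dots> = j - i"
    using ones_minus_zeros[OF assms(1), of i] ones_minus_zeros[OF assms(1), of j] by simp
  finally show ?thesis by simp
qed

text \<open>The factor \<open>t\<close> is present because a step of \<open>1\<close> in a quotient
  word is a step of \<open>t\<close> in the word it is taken from.\<close>

definition hook_prod :: "nat \<Rightarrow> (int \<Rightarrow> nat) \<Rightarrow> rat" where
  "hook_prod t w = (\<Prod>(i, j)\<in>inversions w. of_nat t * of_int (j - i))"

lemma hook_prod_nonzero: "maya w \<Longrightarrow> t > 0 \<Longrightarrow> hook_prod t w \<noteq> 0"
  using finite_inversions[of w] by (auto simp: hook_prod_def inversions_def)

lemma G_word:
  assumes "maya w" "young_diagram p = diagram w"
  shows "G t p = 1 / (\<Prod>(i, j)\<in>{(i, j) \<in> inversions w. int t dvd j - i}. of_int (j - i))"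
proof -
  let ?b = "\<lambda>(i, j). (zeros w j, Suc (ones w i))"
  let ?I = "{(i, j) \<in> inversions w. int t dvd j - i}"
  have hl: "hook_length p (?b c) = nat (snd c - fst c)" if "c \<in> inversions w" for c
    using hook_length_word[OF assms, of "fst c" "snd c"] that by (simp add: case_prod_beta)
  have dvd: "t dvd nat (snd c - fst c) \<longleftrightarrow> int t dvd snd c - fst c" if "c \<in> inversions w" for c
    using that int_dvd_int_iff[of t "nat (snd c - fst c)"] by (auto simp: inversions_def)
  have inj: "inj_on ?b (inversions w)" and img: "?b ` inversions w = diagram w"
    using bij_betw_inversions[OF assms(1)] by (auto simp: bij_betw_def)
  have set: "{c \<in> diagram w. t dvd hook_length p c} = ?b ` ?I"
    unfolding img[symmetric] using hl dvd by fastforce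
  have "(\<Prod>h \<in># filter_mset (\<lambda>h. t dvd h) (hook_lengths p). of_nat h) =
      (\<Prod>c\<in>{c \<in> diagram w. t dvd hook_length p c}. of_nat (hook_length p c) :: rat)"
    unfolding hook_lengths_def assms(2) filter_mset_image_mset
    by (simp add: finite_diagram[OF assms(1)] prod_unfold_prod_mset image_mset.compositionality comp_def)
  also have "\<dots> = (\<Prod>c\<in>?I. of_nat (hook_length p (?b c)))"
    unfolding set by (rule prod.reindex[unfolded comp_def]) (rule inj_on_subset[OF inj], auto)
  also have "\<dots> = (\<Prod>(i, j)\<in>?I. of_int (j - i))"
  proof (rule prod.cong[OF refl])
    fix c assume c: "c \<in> ?I"
    then show "of_nat (hook_length p (?b c)) = (case c of (i, j) \<Rightarrow> of_int (j - i))"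
      using hl[of c] by (auto simp: inversions_def)
  qed
  finally show ?thesis by (simp add: G_def)
qed

text \<open>If \<open>t\<close> divides \<open>j - i\<close>, both positions lie in the same residue
  class. So the hooks of length divisible by \<open>t\<close> are the hooks of the quotients,
  stretched by \<open>t\<close>.\<close>

lemma G_quot:
  assumes "maya w" "young_diagram p = diagram w" "t > 0"
  shows "G t p = (\<Prod>i<t. 1 / hook_prod t (quot_word t w i))"
proof -
  let ?I = "{(i, j) \<in> inversions w. int t dvd j - i}"
  let ?S = "Sigma {..<t} (\<lambda>r. inversions (quot_word t w r))"
  let ?f = "\<lambda>(r, a, b). (int t * a + int r, int t * b + int r)"
  have inj: "inj_on ?f ?S"
  proof (rule inj_onI)
    fix s s' assume s: "s \<in> ?S" "s' \<in> ?S" "?f s = ?f s'"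
    obtain r a b where s1: "s = (r, a, b)" by (metis prod.collapse)
    obtain r' a' b' where s2: "s' = (r', a', b')" by (metis prod.collapse)
    have *: "r < t" "r' < t" "int t * a + int r = int t * a' + int r'"
      "int t * b + int r = int t * b' + int r'" using s by (auto simp: s1 s2)
    have "int r = (int t * a + int r) mod int t" "int r' = (int t * a' + int r') mod int t"
      using *(1,2) by auto
    with *(3) have "r = r'" by simp
    with * assms(3) show "s = s'" by (simp add: s1 s2)
  qed
  have img: "?f ` ?S = ?I"
  proof (intro equalityI subsetI)
    fix c assume "c \<in> ?f ` ?S"
    then show "c \<in> ?I" using assms(3)
      by (auto simp: inversions_def quot_word_def right_diff_distrib[symmetric])
  next
    fix c assume "c \<in> ?I"
    then obtain i j where ij: "c = (i, j)" "i < j" "w i = 1" "w j = 0" "int t dvd j - i"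
      by (auto simp: inversions_def)
    then obtain d where d: "j = i + int t * d" by (metis dvdE diff_eq_eq add.commute)
    define r where "r = nat (i mod int t)"
    have r: "r < t" "i = int t * (i div int t) + int r"
      using assms(3) by (simp_all add: r_def nat_less_iff)
    have j: "j = int t * (i div int t + d) + int r" using r(2) d by (simp add: algebra_simps)
    have "0 < int t * d" using d ij(2) by simp
    then have "0 < d" using assms(3) by (simp add: zero_less_mult_iff)
    then have "(r, i div int t, i div int t + d) \<in> ?S"
      using r j ij by (auto simp: inversions_def quot_word_def)
    moreover have "c = ?f (r, i div int t, i div int t + d)" using r(2) j ij(1) by simp
    ultimately show "c \<in> ?f ` ?S" by blast
  qed
  have "(\<Prod>(i, j)\<in>?I. of_int (j - i) :: rat) = (\<Prod>s\<in>?S. case ?f s of (i, j) \<Rightarrow> of_int (j - i))"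
    unfolding img[symmetric] by (rule prod.reindex[unfolded comp_def, OF inj])
  also have "\<dots> = (\<Prod>(r, a, b)\<in>?S. of_nat t * of_int (b - a))"
    by (rule prod.cong) (auto simp: algebra_simps)
  also have "\<dots> = (\<Prod>r<t. hook_prod t (quot_word t w r))"
    unfolding hook_prod_def
    by (subst prod.Sigma[symmetric]) (auto simp: finite_inversions maya_quot_word assms)
  finally show ?thesis
    using G_word[OF assms(1,2)] by (simp add: prod_dividef)
qed

subsection \<open>Adding a hook\<close>

text \<open>With \<open>w k = 0\<close> and \<open>w (k + s) = 1\<close>, the shift
  \<open>s = t\<close> adds a \<open>t\<close>-hook to a partition and the shift
  \<open>s = 1\<close> adds a box to a quotient.\<close>

definition swap_word :: "int \<Rightarrow> int \<Rightarrow> (int \<Rightarrow> nat) \<Rightarrow> int \<Rightarrow> nat" where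
  "swap_word s k w = w(k := 1, k + s := 0)"

lemma maya_swap_word: "maya w \<Longrightarrow> maya (swap_word s k w)"
proof -
  assume w: "maya w"
  obtain l u where lu: "l \<le> min k (k + s)" "max k (k + s) + 1 \<le> u"
    "\<And>j. j < l \<Longrightarrow> w j = 0" "\<And>j. j \<ge> u \<Longrightarrow> w j = 1"
    using maya_bounds[OF w, of "min k (k+s)" "max k (k+s) + 1"] by metis
  show ?thesis unfolding maya_def
  proof (intro conjI exI)
    show "\<forall>j. swap_word s k w j = 0 \<or> swap_word s k w j = 1"
      using maya_01[OF w] by (auto simp: swap_word_def)
    show "\<forall>j<l. swap_word s k w j = 0" "\<forall>j\<ge>u. swap_word s k w j = 1"
      using lu by (auto simp: swap_word_def)
  qed
qed

text \<open>A single zero moves from \<open>k\<close> to \<open>k + s\<close>. Seen from a position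
  \<open>l\<close> to the left of both, with no ones before it, the number of zeros is unchanged,
  and it determines the charge.\<close>

lemma charge_swap_word:
  assumes "maya w" "w k = 0" "w (k + s) = 1"
  shows "charge (swap_word s k w) = charge w"
proof -
  let ?w = "swap_word s k w"
  obtain l where l: "l \<le> min k (k + s)" "\<And>j. j < l \<Longrightarrow> w j = 0"
    using maya_bounds[OF assms(1), of "min k (k+s)" 0] by metis
  then have l': "\<And>j. j < l \<Longrightarrow> ?w j = 0" by (auto simp: swap_word_def)
  have "{j. l \<le> j \<and> ?w j = 0} = insert (k + s) ({j. l \<le> j \<and> w j = 0} - {k})"
    using l(1) assms(2,3) by (auto simp: swap_word_def)
  then have "zeros ?w l = Suc (card ({j. l \<le> j \<and> w j = 0} - {k}))"
    unfolding zeros_def using assms finite_zeros[OF assms(1), of l] by simp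
  also have "\<dots> = zeros w l"
    unfolding zeros_def using assms(2) l(1) finite_zeros[OF assms(1), of l]
    by (intro card_Suc_Diff1) auto
  finally show ?thesis
    using ones_minus_zeros[OF assms(1), of l] ones_minus_zeros[OF maya_swap_word[OF assms(1)], of s k l]
      ones_eq_0[OF l(2)] ones_eq_0[OF l'] by simp
qed

lemma quot_word_swap:
  assumes "i < t" "i' < t"
  shows "quot_word t (swap_word (int t) (int t * j + int i) w) i' =
    (if i' = i then swap_word 1 j (quot_word t w i) else quot_word t w i')"
proof -
  have *: "int t * m + int i' = int t * n + int i \<longleftrightarrow> m = n \<and> i = i'" for m n
  proof
    assume e: "int t * m + int i' = int t * n + int i"
    have "(int t * m + int i') mod int t = int i'" "(int t * n + int i) mod int t = int i"
      using assms by auto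
    with e have "i' = i" by simp
    with e assms show "m = n \<and> i = i'" by simp
  qed simp
  have **: "int t * n + int i + int t = int t * (n + 1) + int i" for n
    by (simp add: algebra_simps)
  show ?thesis
    unfolding quot_word_def swap_word_def fun_upd_def ** * by auto
qed

text \<open>The exchange alters the jumps of \<open>w\<close> only at the vertices \<open>j\<close>,
  \<open>j + 1\<close>, \<open>j + 2\<close>, by \<open>1\<close>, \<open>-2\<close>,
  \<open>1\<close>, whichever of them were corners before. Hence a second difference appears without
  a case distinction.\<close>

lemma q_word_swap:
  assumes "maya w" "w j = 0" "w (j + 1) = 1"
  defines "x \<equiv> j + 1 - charge w"
  shows "q_word k (swap_word 1 j w) = q_word k w + ((x + 1) ^ k + (x - 1) ^ k - 2 * x ^ k)"
proof -
  let ?w = "swap_word 1 j w" and ?f = "\<lambda>m. (m - charge w) ^ k"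
  note m = maya_swap_word[OF assms(1), of 1 j]
  define S where "S = inner w \<union> outer w \<union> inner ?w \<union> outer ?w \<union> {j, j + 1, j + 2}"
  have fin: "finite S" using finite_inner_outer[OF assms(1)] finite_inner_outer[OF m] by (simp add: S_def)
  let ?d = "\<lambda>m. (int (?w m) - int (?w (m - 1))) - (int (w m) - int (w (m - 1)))"
  have "q_word k ?w - q_word k w = (\<Sum>m\<in>S. (int (?w m) - int (?w (m - 1))) * ?f m) -
      (\<Sum>m\<in>S. (int (w m) - int (w (m - 1))) * ?f m)"
    unfolding q_word_def charge_swap_word[OF assms(1-3)]
    by (intro arg_cong2[of _ _ _ _ "(-)"] sum_jumps assms m fin) (auto simp: S_def)
  also have "\<dots> = (\<Sum>m\<in>S. ?d m * ?f m)"
    by (simp add: sum_subtractf[symmetric] algebra_simps)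
  also have "\<dots> = (\<Sum>m\<in>{j, j + 1, j + 2}. ?d m * ?f m)"
    by (rule sum.mono_neutral_right[OF fin]) (auto simp: S_def swap_word_def)
  also have "\<dots> = ?f j - 2 * ?f (j + 1) + ?f (j + 2)"
    using assms(2,3) by (simp add: swap_word_def algebra_simps)
  also have "\<dots> = (x + 1) ^ k + (x - 1) ^ k - 2 * x ^ k"
  proof -
    have "j - charge w = x - 1" "j + 1 - charge w = x" "j + 2 - charge w = x + 1"
      by (simp_all add: x_def)
    then show ?thesis by (simp only:)
  qed
  finally show ?thesis by simp
qed

section \<open>The change of the hook product\<close>

lemma prod_Diff_swap:
  fixes f :: "'a \<Rightarrow> 'b::comm_monoid_mult"
  assumes "finite A" "finite B"
  shows "prod f A * prod f (B - A) = prod f B * prod f (A - B)"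
proof -
  have "prod f A * prod f (B - A) = prod f (A \<union> (B - A))"
    by (rule prod.union_disjoint[symmetric]) (use assms in auto)
  also have "A \<union> (B - A) = B \<union> (A - B)" by auto
  also have "prod f (B \<union> (A - B)) = prod f B * prod f (A - B)"
    by (rule prod.union_disjoint) (use assms in auto)
  finally show ?thesis .
qed

text \<open>The new box has hook length 1, and the hooks of the boxes in its row and column grow by
  one. So products over a set of positions are compared with products over its shift by one. A set
  and its shift differ only at the ends of runs, and these are the corners of
  \<open>w\<close>.\<close>

lemma hook_prod_swap:
  assumes "maya w" "w k = 0" "w (k + 1) = 1"
  shows "hook_prod t (swap_word 1 k w) * (\<Prod>y\<in>outer w. of_int (k + 1 - y)) =
    of_nat t * hook_prod t w * (\<Prod>x\<in>inner w - {k + 1}. of_int (k + 1 - x))"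
proof -
  let ?w = "swap_word 1 k w"
  define g where "g = (\<lambda>(i, j). of_nat t * of_int (j - i) :: rat)"
  define f where "f m = (of_int (k + 1 - m) :: rat)" for m
  \<comment> \<open>\<open>R\<close> consists of the boxes outside the row and column of the new
    box. \<open>L\<close> indexes the boxes in its row, \<open>U\<close> those in its column.
    Positions in \<open>U\<close> lie to the right of vertex \<open>k + 1\<close>, where
    \<open>f\<close> is negative; this explains the factors \<open>- of_nat t\<close>.\<close>
  define R where "R = {(i, j) \<in> inversions w. i \<noteq> k + 1 \<and> j \<noteq> k}"
  define L where "L = {i. i < k \<and> w i = 1}"
  define U where "U = {j. k + 2 \<le> j \<and> w j = 0}"
  have fin: "finite R" "finite L" "finite U"
    using finite_inversions[OF assms(1)] finite_ones[OF assms(1), of k] finite_zeros[OF assms(1), of "k+2"]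
    by (auto simp: R_def L_def U_def intro: finite_subset[rotated])
  have inv: "inversions w = R \<union> ((\<lambda>i. (i, k)) ` L \<union> (\<lambda>j. (k + 1, j)) ` U)"
    using assms(2,3) by (auto simp: R_def L_def U_def inversions_def)
  have inv': "inversions ?w = insert (k, k + 1) (R \<union> ((\<lambda>i. (i, k + 1)) ` L \<union> (\<lambda>j. (k, j)) ` U))"
    using assms(2,3) by (auto simp: R_def L_def U_def inversions_def swap_word_def split: if_splits)
  have disj: "R \<inter> ((\<lambda>i. (i, k)) ` L \<union> (\<lambda>j. (k + 1, j)) ` U) = {}"
      "(\<lambda>i. (i, k)) ` L \<inter> (\<lambda>j. (k + 1, j)) ` U = {}"
      "R \<inter> ((\<lambda>i. (i, k + 1)) ` L \<union> (\<lambda>j. (k, j)) ` U) = {}"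
      "(\<lambda>i. (i, k + 1)) ` L \<inter> (\<lambda>j. (k, j)) ` U = {}"
      "(k, k + 1) \<notin> R \<union> ((\<lambda>i. (i, k + 1)) ` L \<union> (\<lambda>j. (k, j)) ` U)"
    using assms(2,3) by (auto simp: R_def L_def U_def inversions_def)
  have "hook_prod t w = prod g R * (prod g ((\<lambda>i. (i, k)) ` L) * prod g ((\<lambda>j. (k + 1, j)) ` U))"
    unfolding hook_prod_def inv g_def[symmetric]
    by (simp only: prod.union_disjoint finite_UnI finite_imageI fin disj)
  also have "\<dots> = prod g R * ((\<Prod>i\<in>L. of_nat t * f (i + 1)) * (\<Prod>j\<in>U. - of_nat t * f j))"
    by (subst prod.reindex, simp add: inj_on_def)+ (simp add: g_def f_def algebra_simps)
  finally have 1: "hook_prod t w = prod g R *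
    ((\<Prod>i\<in>L. of_nat t * f (i + 1)) * (\<Prod>j\<in>U. - of_nat t * f j))" .
  have "hook_prod t ?w = g (k, k + 1) * (prod g R *
      (prod g ((\<lambda>i. (i, k + 1)) ` L) * prod g ((\<lambda>j. (k, j)) ` U)))"
    unfolding hook_prod_def inv' g_def[symmetric]
    by (simp only: prod.insert prod.union_disjoint finite_UnI finite_imageI fin disj not_False_eq_True)
  also have "\<dots> = of_nat t * (prod g R * ((\<Prod>i\<in>L. of_nat t * f i) * (\<Prod>j\<in>U. - of_nat t * f (j + 1))))"
    by (subst prod.reindex, simp add: inj_on_def)+ (simp add: g_def f_def algebra_simps)
  finally have 2: "hook_prod t ?w = of_nat t * (prod g R *
    ((\<Prod>i\<in>L. of_nat t * f i) * (\<Prod>j\<in>U. - of_nat t * f (j + 1))))" .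
  \<comment> \<open>A run of ones starts at an inner corner, and its shift ends at an outer corner;
    everything else cancels.\<close>
  have LL: "prod f L * prod f {y \<in> outer w. y < k + 1} =
      (\<Prod>i\<in>L. f (i + 1)) * prod f {x \<in> inner w. x < k + 1}"
  proof -
    have "(\<lambda>i. i + 1) ` L - L = {y \<in> outer w. y < k + 1}" (is "?A = ?B")
    proof (intro set_eqI iffI)
      fix y assume "y \<in> ?A"
      then show "y \<in> ?B"
        using maya_01[OF assms(1), of y] assms(2) by (cases "y = k") (auto simp: L_def outer_def)
    next
      fix y assume "y \<in> ?B"
      then show "y \<in> ?A"
        by (auto simp: L_def outer_def image_iff intro!: exI[of _ "y - 1"])
    qed
    moreover have "L - (\<lambda>i. i + 1) ` L = {x \<in> inner w. x < k + 1}" (is "?A = ?B")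
    proof (intro set_eqI iffI)
      fix y assume y: "y \<in> ?A"
      then have "y - 1 \<notin> L" by (metis DiffD2 diff_add_cancel image_eqI)
      then show "y \<in> ?B"
        using y maya_01[OF assms(1), of "y-1"] by (auto simp: L_def inner_def)
    next
      fix y assume "y \<in> ?B"
      then show "y \<in> ?A"
        using assms(2) by (cases "y = k") (auto simp: L_def inner_def)
    qed
    moreover have "(\<Prod>i\<in>L. f (i + 1)) = prod f ((\<lambda>i. i + 1) ` L)"
      by (simp add: prod.reindex inj_on_def)
    ultimately show ?thesis using prod_Diff_swap[of L "(\<lambda>i. i + 1) ` L" f] fin by simp
  qed
  \<comment> \<open>For runs of zeros the roles are exchanged: they start at outer corners, and
    their shifts end at inner ones. Since the letter at \<open>k + 1\<close> is a one, a zero at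
    \<open>k + 2\<close> starts a run.\<close>
  have UU: "(\<Prod>j\<in>U. f (j + 1)) * prod f {y \<in> outer w. k + 1 < y} =
      prod f U * prod f {x \<in> inner w. k + 1 < x}"
  proof -
    have "(\<lambda>i. i + 1) ` U - U = {x \<in> inner w. k + 1 < x}" (is "?A = ?B")
    proof (intro set_eqI iffI)
      fix y assume "y \<in> ?A"
      then show "y \<in> ?B"
        using maya_01[OF assms(1), of y] by (auto simp: U_def inner_def)
    next
      fix y assume y: "y \<in> ?B"
      have "y - 1 \<in> U"
        using y assms(3) by (cases "y - 1 = k + 1") (auto simp: U_def inner_def)
      then have "y \<in> (\<lambda>i. i + 1) ` U" by (intro image_eqI[of _ _ "y - 1"]) auto
      then show "y \<in> ?A" using y by (auto simp: U_def inner_def)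
    qed
    moreover have "U - (\<lambda>i. i + 1) ` U = {y \<in> outer w. k + 1 < y}" (is "?A = ?B")
    proof (intro set_eqI iffI)
      fix y assume y: "y \<in> ?A"
      then have "y - 1 \<notin> U" by (metis DiffD2 diff_add_cancel image_eqI)
      then show "y \<in> ?B"
        using y maya_01[OF assms(1), of "y-1"] assms(3)
        by (cases "y = k + 2") (auto simp: U_def outer_def add.commute)
    next
      fix y assume "y \<in> ?B"
      then show "y \<in> ?A" by (auto simp: U_def outer_def)
    qed
    moreover have "(\<Prod>i\<in>U. f (i + 1)) = prod f ((\<lambda>i. i + 1) ` U)"
      by (simp add: prod.reindex inj_on_def)
    ultimately show ?thesis using prod_Diff_swap[of "(\<lambda>i. i + 1) ` U" U f] fin by simp
  qed
  note fio = finite_inner_outer[OF assms(1)]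
  have split: "prod f (S - {k + 1}) = prod f {y \<in> S. y < k + 1} * prod f {y \<in> S. k + 1 < y}"
    if "finite S" for S
  proof -
    have "S - {k + 1} = {y \<in> S. y < k + 1} \<union> {y \<in> S. k + 1 < y}" by auto
    moreover have "prod f ({y \<in> S. y < k + 1} \<union> {y \<in> S. k + 1 < y}) =
        prod f {y \<in> S. y < k + 1} * prod f {y \<in> S. k + 1 < y}"
      by (rule prod.union_disjoint) (use that in auto)
    ultimately show ?thesis by simp
  qed
  have "k + 1 \<notin> outer w" using assms(3) by (simp add: outer_def)
  then have Y: "prod f (outer w) = prod f {y \<in> outer w. y < k + 1} * prod f {y \<in> outer w. k + 1 < y}"
    using split[OF fio(2)] by simp
  note X = split[OF fio(1)]
  have "hook_prod t ?w * prod f (outer w) = of_nat t * prod g R * (\<Prod>i\<in>L. of_nat t) * (\<Prod>j\<in>U. - of_nat t) *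
      (prod f L * prod f {y \<in> outer w. y < k + 1}) *
      ((\<Prod>j\<in>U. f (j + 1)) * prod f {y \<in> outer w. k + 1 < y})"
    unfolding 2 Y prod.distrib by (simp only: mult_ac)
  also have "\<dots> = of_nat t * hook_prod t w * prod f (inner w - {k + 1})"
    unfolding LL UU 1 X prod.distrib by (simp only: mult_ac)
  finally show ?thesis by (simp add: f_def)
qed

subsection \<open>Lagrange weights\<close>

text \<open>For \<open>f\<close> injective on \<open>X\<close> and \<open>x\<close> in
  \<open>X\<close>, this is the residue at \<open>z = f x\<close> of
  \<open>(\<Prod>y\<in>Y. z - f y) / (\<Prod>x'\<in>X. z - f x')\<close>.\<close>

definition weight :: "('b \<Rightarrow> 'a) \<Rightarrow> 'b set \<Rightarrow> 'b set \<Rightarrow> 'b \<Rightarrow> 'a::field" where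
  "weight f X Y x = (\<Prod>y\<in>Y. f x - f y) / (\<Prod>x'\<in>X - {x}. f x - f x')"

text \<open>A partial fraction expansion with cleared denominators. Both sides have degree at most
  \<open>card Y\<close>, one less than the number of interpolation points, and at \<open>f x\<close>
  only the summand of \<open>x\<close> survives.\<close>

lemma lagrange_weights:
  fixes f :: "'b \<Rightarrow> 'a::field"
  assumes "finite X" "finite Y" "card X = Suc (card Y)" "inj_on f X"
  shows "(\<Prod>y\<in>Y. z - f y) = (\<Sum>x\<in>X. weight f X Y x * (\<Prod>x'\<in>X - {x}. z - f x'))"
proof -
  define P where "P = (\<Prod>y\<in>Y. [:- f y, 1:])"
  define R where "R = (\<Sum>x\<in>X. smult (weight f X Y x) (\<Prod>x'\<in>X - {x}. [:- f x', 1:]))"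
  have "P = R"
  proof (rule poly_eqI_degree[of "f ` X"])
    show "poly P a = poly R a" if "a \<in> f ` X" for a
    proof -
      from that obtain x where x: "x \<in> X" "a = f x" by blast
      have nz: "(\<Prod>x'\<in>X - {x}. f x - f x') \<noteq> 0"
        using assms x by (auto simp: inj_on_def)
      have "poly R a = (\<Sum>x1\<in>X. if x1 = x then weight f X Y x * (\<Prod>x'\<in>X - {x}. f x - f x') else 0)"
        unfolding R_def poly_sum
      proof (rule sum.cong[OF refl])
        fix x1 assume x1: "x1 \<in> X"
        have "(\<Prod>x'\<in>X - {x1}. f x - f x') = 0" if "x1 \<noteq> x"
          using assms(1) that x by (auto intro!: prod_zero bexI[of _ x])
        then show "poly (smult (weight f X Y x1) (\<Prod>x'\<in>X - {x1}. [:- f x', 1:])) a =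
          (if x1 = x then weight f X Y x * (\<Prod>x'\<in>X - {x}. f x - f x') else 0)"
          using x by (simp add: poly_prod)
      qed
      also have "\<dots> = (\<Prod>y\<in>Y. f x - f y)"
        using assms(1) x nz by (simp add: weight_def)
      also have "\<dots> = poly P a" using x by (simp add: P_def poly_prod)
      finally show ?thesis by simp
    qed
    have deg: "degree (\<Prod>y\<in>S. [:- f y, 1:]) \<le> card S" if "finite S" for S
      using degree_prod_sum_le[OF that, of "\<lambda>y. [:- f y, 1:]"] by simp
    have card: "card (f ` X) = Suc (card Y)" using assms by (simp add: card_image)
    show "degree P < card (f ` X)" using deg[OF assms(2)] by (simp add: P_def card)
    have "degree R \<le> card Y" unfolding R_def
    proof (rule degree_sum_le[OF assms(1)])
      show "degree (smult (weight f X Y x) (\<Prod>x'\<in>X - {x}. [:- f x', 1:])) \<le> card Y" if "x \<in> X" for x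
        using deg[of "X - {x}"] degree_smult_le assms that by (auto intro: order_trans)
    qed
    then show "degree R < card (f ` X)" by (simp add: card)
  qed
  then have "poly P z = poly R z" by simp
  then show ?thesis by (simp add: P_def R_def poly_prod poly_sum)
qed

text \<open>The identity for reversed polynomials: put \<open>z = 1 / a\<close> and multiply by
  \<open>a ^ card Y\<close>, every product having \<open>card Y\<close> factors. Agreement at all
  nonzero \<open>a\<close> forces equality of the polynomials, hence of the series.\<close>

lemma lagrange_weights_fps:
  fixes f :: "'b \<Rightarrow> 'a::field_char_0"
  assumes "finite X" "finite Y" "card X = Suc (card Y)" "inj_on f X"
  defines "L \<equiv> \<lambda>x. 1 - fps_const (f x) * fps_X"
  shows "(\<Prod>y\<in>Y. L y) = (\<Sum>x\<in>X. fps_const (weight f X Y x) * (\<Prod>x'\<in>X - {x}. L x'))"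
proof -
  define P where "P = (\<Prod>y\<in>Y. [:1, - f y:])"
  define R where "R = (\<Sum>x\<in>X. smult (weight f X Y x) (\<Prod>x'\<in>X - {x}. [:1, - f x':]))"
  have scale: "(\<Prod>y\<in>S. 1 - a * f y) = a ^ card S * (\<Prod>y\<in>S. 1 / a - f y)" if "a \<noteq> 0" for a S
    using that by (subst prod_constant[symmetric], subst prod.distrib[symmetric]) (simp add: algebra_simps)
  have "poly P a = poly R a" if "a \<noteq> 0" for a
  proof -
    have "poly P a = a ^ card Y * (\<Prod>y\<in>Y. 1 / a - f y)"
      using scale[OF that, of Y] by (simp add: P_def poly_prod)
    also have "\<dots> = (\<Sum>x\<in>X. weight f X Y x * (a ^ card Y * (\<Prod>x'\<in>X - {x}. 1 / a - f x')))"
      unfolding lagrange_weights[OF assms(1-4)] sum_distrib_left by (simp add: mult_ac)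
    also have "\<dots> = poly R a"
      unfolding R_def poly_sum
    proof (rule sum.cong[OF refl])
      fix x assume "x \<in> X"
      then have "card (X - {x}) = card Y" using assms by simp
      then show "weight f X Y x * (a ^ card Y * (\<Prod>x'\<in>X - {x}. 1 / a - f x')) =
        poly (smult (weight f X Y x) (\<Prod>x'\<in>X - {x}. [:1, - f x':])) a"
        using scale[OF that, of "X - {x}"] by (simp add: poly_prod)
    qed
    finally show ?thesis .
  qed
  then have "UNIV - {0} \<subseteq> {a. poly (P - R) a = 0}" by auto
  moreover have "infinite (UNIV - {0::'a})" by (simp add: infinite_UNIV_char_0)
  ultimately have "P - R = 0" using poly_roots_finite finite_subset by blast
  then have "fps_of_poly P = fps_of_poly R" by simp
  moreover have "fps_of_poly [:1, - c:] = 1 - fps_const c * fps_X" for c :: 'a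
    using fps_of_poly_linear'[of "- c"] by (simp add: fps_const_neg[symmetric] del: fps_const_neg)
  ultimately show ?thesis
    by (simp add: P_def R_def L_def fps_of_poly_prod fps_of_poly_sum fps_of_poly_smult)
qed

text \<open>Newton's identities: the logarithmic derivative of a product is a sum, and each factor
  contributes a geometric series. Multiplication by \<open>fps_X\<close> restores the degree lost by
  differentiation, so the series of power sums starts at exponent \<open>1\<close>.\<close>

lemma fps_X_deriv_prod:
  fixes f :: "'b \<Rightarrow> 'a::field_char_0"
  defines "L \<equiv> \<lambda>x. 1 - fps_const (f x) * fps_X"
  assumes "finite S"
  shows "fps_X * fps_deriv (\<Prod>x\<in>S. L x) =
    - (\<Prod>x\<in>S. L x) * Abs_fps (\<lambda>n. if n = 0 then 0 else \<Sum>x\<in>S. f x ^ n)"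
  using assms(2)
proof (induction S rule: finite_induct)
  case empty
  have "Abs_fps (\<lambda>n. if n = 0 then 0 else \<Sum>x\<in>{}. f x ^ n) = 0" by (rule fps_ext) simp
  then show ?case by simp
next
  case (insert a S)
  let ?p = "\<lambda>S. Abs_fps (\<lambda>n. if n = 0 then 0 else \<Sum>x\<in>S. f x ^ n)"
  have split: "?p (insert a S) = ?p {a} + ?p S"
    using insert by (intro fps_ext) simp
  have "L a * ?p {a} = fps_const (f a) * fps_X"
  proof (rule fps_ext)
    fix n show "fps_nth (L a * ?p {a}) n = fps_nth (fps_const (f a) * fps_X) n"
      by (cases n) (auto simp: L_def algebra_simps fps_X_mult_nth mult.assoc[of fps_X])
  qed
  then have a: "fps_X * fps_deriv (L a) = - (L a * ?p {a})" by (simp add: L_def mult.commute)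
  have "fps_X * fps_deriv (\<Prod>x\<in>insert a S. L x) =
      L a * (fps_X * fps_deriv (prod L S)) + (fps_X * fps_deriv (L a)) * prod L S"
    using insert.hyps by (simp add: algebra_simps)
  also have "\<dots> = - (\<Prod>x\<in>insert a S. L x) * ?p (insert a S)"
    unfolding insert.IH a split using insert.hyps by (simp add: algebra_simps)
  finally show ?case .
qed

text \<open>The generating function of the moments is
  \<open>(\<Prod>y. 1 - f y * T) / (\<Prod>x. 1 - f x * T)\<close>, and its logarithmic derivative
  gives a recursion of Newton type.\<close>

lemma moment_recursion:
  fixes f :: "'b \<Rightarrow> 'a::field_char_0"
  assumes "finite X" "finite Y" "card X = Suc (card Y)" "inj_on f X"
  defines "mom \<equiv> \<lambda>n. \<Sum>x\<in>X. weight f X Y x * f x ^ n"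
  shows "mom 0 = 1"
    "of_nat n * mom n = (\<Sum>s=1..n. ((\<Sum>x\<in>X. f x ^ s) - (\<Sum>y\<in>Y. f y ^ s)) * mom (n - s))"
proof -
  define L where "L = (\<lambda>x. 1 - fps_const (f x) * fps_X)"
  define geo where "geo x = Abs_fps (\<lambda>n. f x ^ n)" for x
  define p where "p S = Abs_fps (\<lambda>n. if n = 0 then 0 else \<Sum>x\<in>S. f x ^ n)" for S
  define A where "A = Abs_fps mom"
  let ?D = "\<Prod>x\<in>X. L x" and ?N = "\<Prod>y\<in>Y. L y"
  have L_geo: "L x * geo x = 1" for x
  proof (rule fps_ext)
    fix n show "fps_nth (L x * geo x) n = fps_nth 1 n"
      by (cases n) (auto simp: L_def geo_def algebra_simps fps_X_mult_nth mult.assoc[of fps_X])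
  qed
  have A: "A = (\<Sum>x\<in>X. fps_const (weight f X Y x) * geo x)"
    by (rule fps_ext) (simp add: A_def mom_def geo_def fps_sum_nth)
  have "A * ?D = (\<Sum>x\<in>X. fps_const (weight f X Y x) * (\<Prod>x'\<in>X - {x}. L x'))"
    unfolding A sum_distrib_right
  proof (rule sum.cong[OF refl])
    fix x assume "x \<in> X"
    then have D: "?D = L x * (\<Prod>x'\<in>X - {x}. L x')" using assms(1) by (rule prod.remove[rotated])
    have "fps_const (weight f X Y x) * geo x * ?D =
        fps_const (weight f X Y x) * (L x * geo x) * (\<Prod>x'\<in>X - {x}. L x')"
      unfolding D by (simp only: mult_ac)
    then show "fps_const (weight f X Y x) * geo x * ?D = fps_const (weight f X Y x) * (\<Prod>x'\<in>X - {x}. L x')"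
      by (simp add: L_geo)
  qed
  also have "\<dots> = ?N" unfolding L_def by (rule lagrange_weights_fps[OF assms(1-4), symmetric])
  finally have AD: "A * ?D = ?N" .
  have nth0: "fps_nth (\<Prod>x\<in>S. L x) 0 = 1" if "finite S" for S
    using that by (induction S rule: finite_induct) (simp_all add: L_def)
  show "mom 0 = 1"
    using arg_cong[OF AD, of "\<lambda>h. fps_nth h 0"] nth0[OF assms(1)] nth0[OF assms(2)] by (simp add: A_def)
  note dD = fps_X_deriv_prod[OF assms(1), of f, folded L_def p_def]
  note dN = fps_X_deriv_prod[OF assms(2), of f, folded L_def p_def]
  have "fps_X * fps_deriv A * ?D + A * (fps_X * fps_deriv ?D) = fps_X * fps_deriv ?N"
    by (subst AD[symmetric]) (simp add: algebra_simps)
  then have "(fps_X * fps_deriv A) * ?D = (A * (p X - p Y)) * ?D"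
    unfolding dD dN unfolding AD[symmetric] by (simp add: algebra_simps)
  moreover have "?D \<noteq> 0" using nth0[OF assms(1)] by auto
  ultimately have "fps_X * fps_deriv A = (p X - p Y) * A" by (simp add: mult.commute)
  then have "fps_nth (fps_X * fps_deriv A) n = fps_nth ((p X - p Y) * A) n" by simp
  moreover have "fps_nth (fps_X * fps_deriv A) n = of_nat n * mom n"
    by (cases n) (simp_all add: A_def fps_X_mult_nth)
  moreover have "fps_nth ((p X - p Y) * A) n =
      (\<Sum>s=1..n. ((\<Sum>x\<in>X. f x ^ s) - (\<Sum>y\<in>Y. f y ^ s)) * mom (n - s))"
    unfolding fps_mult_nth
    by (rule sum.mono_neutral_cong_right) (auto simp: p_def A_def)
  ultimately show "of_nat n * mom n = (\<Sum>s=1..n. ((\<Sum>x\<in>X. f x ^ s) - (\<Sum>y\<in>Y. f y ^ s)) * mom (n - s))"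
    by simp
qed

subsection \<open>Functions of bounded weight\<close>

text \<open>A filtration on the polynomials in the \<open>q k\<close> of the quotients, with
  \<open>q k\<close> in weight \<open>k\<close>. Weights are integers and constants enter only at
  weight \<open>0\<close>, which leaves nothing but \<open>0\<close> in negative weight. The bound
  \<open>1 \<le> k\<close> matches the positivity of the parts of a partition.\<close>

inductive wt :: "nat \<Rightarrow> int \<Rightarrow> (nat list \<Rightarrow> rat) \<Rightarrow> bool" for t where
  wt_zero: "wt t n (\<lambda>p. 0)"
| wt_const: "0 \<le> n \<Longrightarrow> wt t n (\<lambda>p. c)"
| wt_q: "i < t \<Longrightarrow> 1 \<le> k \<Longrightarrow> int k \<le> n \<Longrightarrow> wt t n (\<lambda>p. q k (t_quotient t p i))"
| wt_add: "wt t n f \<Longrightarrow> wt t n g \<Longrightarrow> wt t n (\<lambda>p. f p + g p)"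
| wt_mult: "wt t m f \<Longrightarrow> wt t n g \<Longrightarrow> wt t (m + n) (\<lambda>p. f p * g p)"
| wt_mono: "wt t m f \<Longrightarrow> m \<le> n \<Longrightarrow> wt t n f"

lemma wt_scale: "wt t n f \<Longrightarrow> wt t n (\<lambda>p. c * f p)"
  using wt_mult[OF wt_const[of 0 t c], of n f] by simp

lemma wt_sum: "finite A \<Longrightarrow> (\<And>a. a \<in> A \<Longrightarrow> wt t n (f a)) \<Longrightarrow> wt t n (\<lambda>p. \<Sum>a\<in>A. f a p)"
  by (induction A rule: finite_induct) (auto intro: wt_zero wt_add)

lemma wt_prod:
  "finite A \<Longrightarrow> (\<And>a. a \<in> A \<Longrightarrow> wt t (n a) (f a)) \<Longrightarrow> wt t (\<Sum>a\<in>A. n a) (\<lambda>p. \<Prod>a\<in>A. f a p)"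
  by (induction A rule: finite_induct) (auto intro: wt_const wt_mult)

lemma wt_q_part:
  assumes "i < t" "\<forall>k\<in>set \<delta>. 0 < k"
  shows "wt t (int (sum_list \<delta>)) (\<lambda>p. q_part \<delta> (t_quotient t p i))"
  using assms(2)
proof (induction \<delta>)
  case (Cons k \<delta>)
  then have "wt t (int k + int (sum_list \<delta>))
      (\<lambda>p. q k (t_quotient t p i) * q_part \<delta> (t_quotient t p i))"
    using assms(1) by (intro wt_mult wt_q) auto
  then show ?case by (simp add: q_part_def)
qed (simp add: q_part_def wt_const)

section \<open>Monomials indexed by tuples of partitions\<close>

definition indices :: "nat \<Rightarrow> int \<Rightarrow> (nat \<Rightarrow> nat list) set" where
  "indices t n = {\<delta> \<in> {..<t} \<rightarrow>\<^sub>E Collect is_partition. int (\<Sum>i<t. sum_list (\<delta> i)) \<le> n}"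

definition monomial :: "nat \<Rightarrow> (nat \<Rightarrow> nat list) \<Rightarrow> nat list \<Rightarrow> rat" where
  "monomial t \<delta> p = (\<Prod>i<t. q_part (\<delta> i) (t_quotient t p i))"

lemma indices_iff:
  "\<delta> \<in> indices t n \<longleftrightarrow> (\<forall>i<t. is_partition (\<delta> i)) \<and> \<delta> \<in> extensional {..<t} \<and>
     int (\<Sum>i<t. sum_list (\<delta> i)) \<le> n"
  by (simp add: indices_def PiE_iff Ball_def del: of_nat_sum)

lemma finite_indices: "finite (indices t n)"
proof -
  let ?P = "{xs. set xs \<subseteq> {..nat n} \<and> length xs \<le> nat n}"
  have "finite ({..<t} \<rightarrow>\<^sub>E ?P)"
    by (intro finite_PiE finite_lists_length_le) auto
  moreover have "indices t n \<subseteq> {..<t} \<rightarrow>\<^sub>E ?P"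
  proof
    fix \<delta> assume \<delta>: "\<delta> \<in> indices t n"
    have "\<delta> i \<in> ?P" if i: "i < t" for i
    proof -
      have "sum_list (\<delta> i) \<le> (\<Sum>i<t. sum_list (\<delta> i))"
        using i by (intro member_le_sum) auto
      moreover have "int (\<Sum>i<t. sum_list (\<delta> i)) \<le> n" using \<delta> by (simp only: indices_iff)
      ultimately have le: "sum_list (\<delta> i) \<le> nat n" by linarith
      have pos: "\<forall>k\<in>set (\<delta> i). 0 < k" using \<delta> i by (simp add: indices_iff is_partition_def)
      have "length xs \<le> sum_list xs" if "\<forall>k\<in>set xs. 0 < k" for xs :: "nat list"
        using that by (induction xs) auto
      then have "length (\<delta> i) \<le> nat n" using pos le by (meson order_trans)
      moreover have "set (\<delta> i) \<subseteq> {..nat n}" using member_le_sum_list le by fastforce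
      ultimately show ?thesis by simp
    qed
    then show "\<delta> \<in> {..<t} \<rightarrow>\<^sub>E ?P" using \<delta> by (simp add: indices_iff PiE_iff)
  qed
  ultimately show ?thesis by (rule finite_subset[rotated])
qed

text \<open>The explicit form asked for in the theorem, with \<open>b\<close> chosen before
  \<open>p\<close>. Weight estimates are done with \<open>wt\<close>, which
  \<open>wt_imp_spanned\<close> translates into this form.\<close>

definition spanned :: "nat \<Rightarrow> int \<Rightarrow> (nat list \<Rightarrow> rat) \<Rightarrow> bool" where
  "spanned t n f \<longleftrightarrow> (\<exists>b. \<forall>p. f p = (\<Sum>\<delta>\<in>indices t n. b \<delta> * monomial t \<delta> p))"

lemma spanned_monomial:
  assumes "\<delta> \<in> indices t n"
  shows "spanned t n (monomial t \<delta>)"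
  unfolding spanned_def
proof (intro exI[of _ "\<lambda>\<epsilon>. if \<epsilon> = \<delta> then 1 else 0"] allI)
  show "monomial t \<delta> p = (\<Sum>\<epsilon>\<in>indices t n. (if \<epsilon> = \<delta> then 1 else 0) * monomial t \<epsilon> p)" for p
    using assms finite_indices[of t n] by (simp add: if_distrib[of "\<lambda>c. c * _"] cong: if_cong)
qed

lemma spanned_zero: "spanned t n (\<lambda>p. 0)"
  unfolding spanned_def by (rule exI[of _ "\<lambda>_. 0"]) simp

lemma spanned_add: "spanned t n f \<Longrightarrow> spanned t n g \<Longrightarrow> spanned t n (\<lambda>p. f p + g p)"
  unfolding spanned_def
proof (elim exE)
  fix b c
  assume "\<forall>p. f p = (\<Sum>\<delta>\<in>indices t n. b \<delta> * monomial t \<delta> p)"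
    "\<forall>p. g p = (\<Sum>\<delta>\<in>indices t n. c \<delta> * monomial t \<delta> p)"
  then show "\<exists>b. \<forall>p. f p + g p = (\<Sum>\<delta>\<in>indices t n. b \<delta> * monomial t \<delta> p)"
    by (intro exI[of _ "\<lambda>\<delta>. b \<delta> + c \<delta>"]) (simp add: distrib_right sum.distrib)
qed

lemma spanned_scale: "spanned t n f \<Longrightarrow> spanned t n (\<lambda>p. c * f p)"
  unfolding spanned_def
proof (elim exE)
  fix b
  assume "\<forall>p. f p = (\<Sum>\<delta>\<in>indices t n. b \<delta> * monomial t \<delta> p)"
  then show "\<exists>b. \<forall>p. c * f p = (\<Sum>\<delta>\<in>indices t n. b \<delta> * monomial t \<delta> p)"
    by (intro exI[of _ "\<lambda>\<delta>. c * b \<delta>"]) (simp add: sum_distrib_left mult.assoc)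
qed

lemma spanned_sum:
  "finite A \<Longrightarrow> (\<And>a. a \<in> A \<Longrightarrow> spanned t n (f a)) \<Longrightarrow> spanned t n (\<lambda>p. \<Sum>a\<in>A. f a p)"
  by (induction A rule: finite_induct) (auto intro: spanned_zero spanned_add)

lemma spanned_mono:
  assumes "spanned t m f" "m \<le> n"
  shows "spanned t n f"
proof -
  obtain b where b: "\<And>p. f p = (\<Sum>\<delta>\<in>indices t m. b \<delta> * monomial t \<delta> p)"
    using assms(1) by (auto simp: spanned_def)
  have "indices t m \<subseteq> indices t n" using assms(2) by (auto simp only: indices_iff)
  then have "spanned t n (\<lambda>p. \<Sum>\<delta>\<in>indices t m. b \<delta> * monomial t \<delta> p)"
    by (intro spanned_sum finite_indices spanned_scale spanned_monomial) auto
  then show ?thesis by (simp add: b[abs_def])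
qed

lemma monomial_mult:
  assumes "\<delta> \<in> indices t m" "\<epsilon> \<in> indices t n"
  shows "\<exists>\<mu>\<in>indices t (m + n). \<forall>p. monomial t \<delta> p * monomial t \<epsilon> p = monomial t \<mu> p"
proof -
  \<comment> \<open>The parts are merged in each component; \<open>rev\<close> turns the increasing
    result of \<open>sort\<close> into the decreasing order of a partition.\<close>
  define \<mu> where "\<mu> = (\<lambda>i\<in>{..<t}. rev (sort (\<delta> i @ \<epsilon> i)))"
  have "is_partition (\<mu> i)" if "i < t" for i
    using assms that by (auto simp: \<mu>_def indices_iff is_partition_def sorted_wrt_rev)
  moreover have sum: "sum_list (\<mu> i) = sum_list (\<delta> i) + sum_list (\<epsilon> i)" if "i < t" for i
  proof -
    have "sum_list (rev (sort xs)) = sum_list xs" for xs :: "nat list"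
      by (metis mset_rev mset_sort sum_mset_sum_list)
    then show ?thesis using that by (simp add: \<mu>_def del: sum_list_rev)
  qed
  ultimately have "\<mu> \<in> indices t (m + n)"
    using assms by (simp add: indices_iff sum.distrib) (simp add: \<mu>_def)
  moreover have "q_part (\<mu> i) p = q_part (\<delta> i) p * q_part (\<epsilon> i) p" if "i < t" for i p
  proof -
    have "q_part (rev (sort xs)) p = q_part xs p" for xs
      unfolding q_part_def prod_mset_prod_list[symmetric] by simp
    then show ?thesis using that by (simp add: \<mu>_def q_part_def)
  qed
  then have "monomial t \<delta> p * monomial t \<epsilon> p = monomial t \<mu> p" for p
    by (simp add: monomial_def prod.distrib[symmetric])
  ultimately show ?thesis by blast
qed

lemma spanned_mult:
  assumes "spanned t m f" "spanned t n g"
  shows "spanned t (m + n) (\<lambda>p. f p * g p)"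
proof -
  obtain b where b: "\<And>p. f p = (\<Sum>\<delta>\<in>indices t m. b \<delta> * monomial t \<delta> p)"
    using assms(1) by (auto simp: spanned_def)
  obtain c where c: "\<And>p. g p = (\<Sum>\<delta>\<in>indices t n. c \<delta> * monomial t \<delta> p)"
    using assms(2) by (auto simp: spanned_def)
  have "f p * g p = (\<Sum>\<delta>\<in>indices t m. \<Sum>\<epsilon>\<in>indices t n.
      b \<delta> * c \<epsilon> * (monomial t \<delta> p * monomial t \<epsilon> p))" for p
    unfolding b c by (simp add: sum_product mult_ac)
  moreover have "spanned t (m + n) (\<lambda>p. \<Sum>\<delta>\<in>indices t m. \<Sum>\<epsilon>\<in>indices t n.
      b \<delta> * c \<epsilon> * (monomial t \<delta> p * monomial t \<epsilon> p))"
  proof (intro spanned_sum finite_indices spanned_scale)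
    fix \<delta> \<epsilon> assume "\<delta> \<in> indices t m" "\<epsilon> \<in> indices t n"
    then obtain \<mu> where "\<mu> \<in> indices t (m + n)"
      "\<forall>p. monomial t \<delta> p * monomial t \<epsilon> p = monomial t \<mu> p"
      using monomial_mult by blast
    then show "spanned t (m + n) (\<lambda>p. monomial t \<delta> p * monomial t \<epsilon> p)"
      using spanned_monomial by (metis (no_types, lifting) ext)
  qed
  ultimately show ?thesis by simp
qed

lemma wt_imp_spanned:
  assumes "wt t n f"
  shows "spanned t n f"
  using assms
proof induction
  case (wt_const n c)
  define \<delta> where "\<delta> = (\<lambda>i\<in>{..<t}. [] :: nat list)"
  have "\<delta> \<in> indices t n" using wt_const by (simp add: \<delta>_def indices_iff is_partition_def)
  then have "spanned t n (\<lambda>p. c * monomial t \<delta> p)" by (intro spanned_scale spanned_monomial)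
  moreover have "monomial t \<delta> p = 1" for p by (simp add: monomial_def \<delta>_def q_part_def)
  ultimately show ?case by simp
next
  case (wt_q i k n)
  define \<delta> where "\<delta> = (\<lambda>j\<in>{..<t}. if j = i then [k] else [])"
  have "(\<Sum>j<t. sum_list (\<delta> j)) = (\<Sum>j<t. if j = i then k else 0)"
    by (rule sum.cong) (auto simp: \<delta>_def)
  also have "\<dots> = k" using wt_q(1) by simp
  finally have sum: "(\<Sum>j<t. sum_list (\<delta> j)) = k" .
  have "\<delta> \<in> indices t n"
    unfolding indices_iff sum using wt_q by (simp add: \<delta>_def is_partition_def)
  moreover have "monomial t \<delta> p = q k (t_quotient t p i)" for p
  proof -
    have "monomial t \<delta> p = (\<Prod>j<t. if j = i then q k (t_quotient t p i) else 1)"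
      unfolding monomial_def by (rule prod.cong) (auto simp: \<delta>_def q_part_def)
    then show ?thesis using wt_q(1) by simp
  qed
  ultimately show ?case using spanned_monomial by (metis (no_types, lifting) ext)
qed (auto intro: spanned_zero spanned_add spanned_mult spanned_mono)

text \<open>In \<open>wtx\<close> there is an additional variable of weight \<open>1\<close>,
  the content of a box to be added to one of the quotients.\<close>

inductive wtx :: "nat \<Rightarrow> int \<Rightarrow> (nat list \<Rightarrow> int \<Rightarrow> rat) \<Rightarrow> bool" for t where
  wtx_base: "wt t n a \<Longrightarrow> wtx t (n + int r) (\<lambda>p x. a p * of_int x ^ r)"
| wtx_add: "wtx t n F \<Longrightarrow> wtx t n F' \<Longrightarrow> wtx t n (\<lambda>p x. F p x + F' p x)"
| wtx_mono: "wtx t m F \<Longrightarrow> m \<le> n \<Longrightarrow> wtx t n F"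

lemma wtx_wt: "wt t n a \<Longrightarrow> wtx t n (\<lambda>p x. a p)"
  using wtx_base[of t n a 0] by simp

lemma wtx_power: "int r \<le> n \<Longrightarrow> wtx t n (\<lambda>p x. of_int x ^ r)"
  using wtx_mono[OF wtx_base[OF wt_const[of 0 t 1], of r]] by simp

lemma wtx_mult:
  assumes "wtx t m F" "wtx t n F'"
  shows "wtx t (m + n) (\<lambda>p x. F p x * F' p x)"
  using assms(1)
proof induction
  case (wtx_base m a r)
  show ?case using assms(2)
  proof induction
    case (wtx_base n b s)
    have "wtx t ((m + n) + int (r + s)) (\<lambda>p x. (a p * b p) * of_int x ^ (r + s))"
      by (intro wtx.wtx_base wt_mult \<open>wt t m a\<close> \<open>wt t n b\<close>)
    then show ?case by (simp add: power_add algebra_simps)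
  next
    case (wtx_add n F F')
    then show ?case using wtx.wtx_add by (simp add: distrib_left)
  next
    case (wtx_mono n F n')
    then show ?case using wtx.wtx_mono[of t "m + int r + n"] by simp
  qed
next
  case (wtx_add m F1 F2)
  then show ?case using wtx.wtx_add by (simp add: distrib_right)
next
  case (wtx_mono m F m')
  then show ?case using wtx.wtx_mono[of t "m + n"] by simp
qed

text \<open>With \<open>u k\<close> and \<open>v k\<close> for the two expressions,
  \<open>u (k + 1) = x * u k + v k\<close> and \<open>v (k + 1) = x * v k + u k + 2 * x ^ k\<close>,
  so both bounds follow in one induction. Where a bound is negative the expression vanishes.\<close>

lemma wtx_second_difference:
  "wtx t (int k - 2) (\<lambda>p x. of_int ((x + 1) ^ k + (x - 1) ^ k - 2 * x ^ k))"
  "wtx t (int k - 1) (\<lambda>p x. of_int ((x + 1) ^ k - (x - 1) ^ k))"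
proof (induction k)
  case 0
  show "wtx t (int 0 - 2) (\<lambda>p x. of_int ((x + 1) ^ 0 + (x - 1) ^ 0 - 2 * x ^ 0))"
    "wtx t (int 0 - 1) (\<lambda>p x. of_int ((x + 1) ^ 0 - (x - 1) ^ 0))"
    using wtx_wt[OF wt_zero] by simp_all
next
  case (Suc k)
  have x: "wtx t 1 (\<lambda>p x. of_int x)" using wtx_power[of 1 1 t] by simp
  note xu = wtx_mult[OF x Suc.IH(1)] and xv = wtx_mult[OF x Suc.IH(2)]
  have "wtx t (int (Suc k) - 2) (\<lambda>p x.
      of_int x * of_int ((x + 1) ^ k + (x - 1) ^ k - 2 * x ^ k) + of_int ((x + 1) ^ k - (x - 1) ^ k))"
    by (rule wtx_add[OF wtx_mono[OF xu] wtx_mono[OF Suc.IH(2)]]) auto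
  then show "wtx t (int (Suc k) - 2) (\<lambda>p x. of_int ((x + 1) ^ Suc k + (x - 1) ^ Suc k - 2 * x ^ Suc k))"
    by (simp add: algebra_simps)
  have "wtx t (int (Suc k) - 1) (\<lambda>p x.
      of_int x * of_int ((x + 1) ^ k - (x - 1) ^ k) +
      (of_int ((x + 1) ^ k + (x - 1) ^ k - 2 * x ^ k) + (of_int x ^ k + of_int x ^ k)))"
    by (intro wtx_add wtx_mono[OF xv] wtx_mono[OF Suc.IH(1)] wtx_power) auto
  then show "wtx t (int (Suc k) - 1) (\<lambda>p x. of_int ((x + 1) ^ Suc k - (x - 1) ^ Suc k))"
    by (simp add: algebra_simps)
qed

subsection \<open>The difference operator\<close>

abbreviation qword :: "nat \<Rightarrow> nat list \<Rightarrow> nat \<Rightarrow> int \<Rightarrow> nat" where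
  "qword t p i \<equiv> quot_word t (zero_one_seq p) i"

lemma maya_qword: "is_partition p \<Longrightarrow> t > 0 \<Longrightarrow> maya (qword t p i)"
  by (intro maya_quot_word zero_one_seq)

lemma q_quotient:
  assumes "is_partition p" "t > 0"
  shows "q k (t_quotient t p i) = of_int (q_word k (qword t p i))"
  by (intro q_eq_q_word t_quotient maya_qword assms)

definition part_of :: "(int \<Rightarrow> nat) \<Rightarrow> nat list" where
  "part_of w = (THE p. is_partition p \<and> young_diagram p = diagram w)"

lemma part_of:
  assumes "maya w"
  shows "is_partition (part_of w)" "young_diagram (part_of w) = diagram w"
proof -
  have "\<exists>!p. is_partition p \<and> young_diagram p = diagram w"
    using partition_of_down_closed[OF finite_diagram[OF assms] down_closed_diagram] young_diagram_inj
    by metis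
  from theI'[OF this] show "is_partition (part_of w)" "young_diagram (part_of w) = diagram w"
    unfolding part_of_def by blast+
qed

lemma zero_one_seq_part_of: "maya w \<Longrightarrow> charge w = 0 \<Longrightarrow> zero_one_seq (part_of w) = w"
  by (intro zero_one_seq_unique) (simp_all add: part_of)

text \<open>Here \<open>x\<close> is an inner corner of the \<open>i\<close>-th quotient word. The
  edges \<open>x - 1\<close> and \<open>x\<close> of that word are the edges
  \<open>t * (x - 1) + i\<close> and \<open>t * x + i\<close> of the whole word.\<close>

definition add_at :: "nat \<Rightarrow> nat list \<Rightarrow> nat \<Rightarrow> int \<Rightarrow> nat list" where
  "add_at t p i x = part_of (swap_word (int t) (int t * (x - 1) + int i) (zero_one_seq p))"

lemma inner_qwordD:
  assumes "x \<in> inner (qword t p i)"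
  shows "zero_one_seq p (int t * (x - 1) + int i) = 0"
    "zero_one_seq p (int t * (x - 1) + int i + int t) = 1"
proof -
  have "int t * (x - 1) + int i + int t = int t * x + int i" by (simp add: algebra_simps)
  then show "zero_one_seq p (int t * (x - 1) + int i + int t) = 1"
    using assms by (simp only:) (simp add: inner_def quot_word_def)
  show "zero_one_seq p (int t * (x - 1) + int i) = 0"
    using assms by (simp add: inner_def quot_word_def)
qed

lemma add_at:
  assumes "is_partition p" "x \<in> inner (qword t p i)"
  shows "is_partition (add_at t p i x)"
    "zero_one_seq (add_at t p i x) = swap_word (int t) (int t * (x - 1) + int i) (zero_one_seq p)"
proof -
  let ?w = "swap_word (int t) (int t * (x - 1) + int i) (zero_one_seq p)"
  have m: "maya ?w" using zero_one_seq(1)[OF assms(1)] by (rule maya_swap_word)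
  have "charge ?w = 0"
    using charge_swap_word[OF zero_one_seq(1)[OF assms(1)] inner_qwordD[OF assms(2)]]
      zero_one_seq(3)[OF assms(1)] by simp
  with m show "is_partition (add_at t p i x)" "zero_one_seq (add_at t p i x) = ?w"
    unfolding add_at_def by (simp_all add: part_of zero_one_seq_part_of)
qed

text \<open>Division with remainder by \<open>t\<close> turns the position of an added hook into a
  quotient and an inner corner of it.\<close>

lemma sum_adds_hook:
  assumes "is_partition p" "t > 0"
  shows "(\<Sum>p' | adds_hook t p p'. h p') = (\<Sum>i<t. \<Sum>x\<in>inner (qword t p i). h (add_at t p i x))"
proof -
  let ?S = "Sigma {..<t} (\<lambda>i. inner (qword t p i))"
  let ?f = "\<lambda>(i, x). add_at t p i x"
  let ?z = "zero_one_seq p"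
  have inj: "inj_on ?f ?S"
  proof (rule inj_onI)
    fix s s' assume s: "s \<in> ?S" "s' \<in> ?S" "?f s = ?f s'"
    obtain i x where s1: "s = (i, x)" by force
    obtain i' x' where s2: "s' = (i', x')" by force
    let ?k = "int t * (x - 1) + int i" and ?k' = "int t * (x' - 1) + int i'"
    have "swap_word (int t) ?k ?z = swap_word (int t) ?k' ?z"
      using s add_at(2)[OF assms(1), of x t i] add_at(2)[OF assms(1), of x' t i'] by (simp add: s1 s2)
    \<comment> \<open>The position \<open>?k\<close> can be recovered from the enlarged word: it is
      the only place where a zero has become a one.\<close>
    then have "swap_word (int t) ?k ?z ?k = swap_word (int t) ?k' ?z ?k" by simp
    then have k: "?k = ?k'"
      using inner_qwordD(1)[of x t p i] s assms(2) by (simp add: s1 s2 swap_word_def split: if_splits)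
    have "?k mod int t = int i" "?k' mod int t = int i'"
      using s by (auto simp: s1 s2)
    with k have "i = i'" by simp
    with k assms(2) show "s = s'" by (simp add: s1 s2)
  qed
  have img: "?f ` ?S = {p'. adds_hook t p p'}"
  proof (intro equalityI subsetI)
    fix p' assume "p' \<in> ?f ` ?S"
    then obtain i x where "p' = add_at t p i x" "x \<in> inner (qword t p i)" by auto
    then show "p' \<in> {p'. adds_hook t p p'}"
      using add_at[OF assms(1), of x t i] inner_qwordD[of x t p i]
      unfolding adds_hook_def swap_word_def by blast
  next
    fix p' assume "p' \<in> {p'. adds_hook t p p'}"
    then obtain k where k: "is_partition p'" "?z k = 0" "?z (k + int t) = 1"
      "zero_one_seq p' = swap_word (int t) k ?z"
      by (auto simp: adds_hook_def swap_word_def)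
    define i where "i = nat (k mod int t)"
    define x where "x = k div int t + 1"
    have i: "i < t" and kx: "k = int t * (x - 1) + int i"
      using assms(2) by (simp_all add: i_def x_def nat_less_iff)
    have kx': "k + int t = int t * x + int i" using kx by (simp add: algebra_simps)
    have x: "x \<in> inner (qword t p i)"
      using k(2)[unfolded kx] k(3)[unfolded kx'] by (simp add: inner_def quot_word_def)
    have "zero_one_seq p' = zero_one_seq (add_at t p i x)"
      using add_at(2)[OF assms(1) x] k(4) kx by simp
    then have "p' = add_at t p i x"
      using zero_one_seq(2)[OF k(1)] zero_one_seq(2)[OF add_at(1)[OF assms(1) x]]
        young_diagram_inj[OF k(1) add_at(1)[OF assms(1) x]] by simp
    with i x show "p' \<in> ?f ` ?S" by (auto intro!: image_eqI[of _ _ "(i, x)"])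
  qed
  have "(\<Sum>p' | adds_hook t p p'. h p') = (\<Sum>s\<in>?S. h (?f s))"
    unfolding img[symmetric] by (rule sum.reindex[unfolded comp_def, OF inj])
  also have "\<dots> = (\<Sum>(i, x)\<in>?S. h (add_at t p i x))" by (rule sum.cong) auto
  also have "\<dots> = (\<Sum>i<t. \<Sum>x\<in>inner (qword t p i). h (add_at t p i x))"
    by (subst sum.Sigma[symmetric]) (auto simp: finite_inner_outer maya_qword assms)
  finally show ?thesis .
qed

lemma qword_add_at:
  assumes "is_partition p" "x \<in> inner (qword t p i)" "i < t" "i' < t"
  shows "qword t (add_at t p i x) i' =
    (if i' = i then swap_word 1 (x - 1) (qword t p i) else qword t p i')"
  unfolding add_at(2)[OF assms(1,2)] using quot_word_swap[OF assms(3,4)] .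

text \<open>Only differences of positions enter the weight, so the charge drops out of its value.
  Writing it with contents makes the moments those of \<open>moment_recursion\<close>.\<close>

definition box_weight :: "(int \<Rightarrow> nat) \<Rightarrow> int \<Rightarrow> rat" where
  "box_weight w = weight (\<lambda>m. of_int (m - charge w)) (inner w) (outer w)"

text \<open>Only the factor of the \<open>i\<close>-th quotient changes;
  \<open>hook_prod_swap\<close> gives its change, and the factor \<open>t\<close> of the new box
  becomes the denominator.\<close>

lemma G_add_at:
  assumes "is_partition p" "x \<in> inner (qword t p i)" "i < t"
  shows "G t (add_at t p i x) = G t p * (box_weight (qword t p i) x / of_nat t)"
proof -
  let ?w = "qword t p i"
  have t: "t > 0" using assms(3) by simp
  have m: "maya ?w" using maya_qword[OF assms(1) t] .
  have G: "G t r = (\<Prod>j<t. 1 / hook_prod t (qword t r j))" if "is_partition r" for r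
    using G_quot zero_one_seq[OF that] t by metis
  have rest: "(\<Prod>j\<in>{..<t} - {i}. 1 / hook_prod t (qword t (add_at t p i x) j)) =
      (\<Prod>j\<in>{..<t} - {i}. 1 / hook_prod t (qword t p j))"
    by (rule prod.cong) (auto simp: qword_add_at[OF assms])
  have x: "?w (x - 1) = 0" "?w (x - 1 + 1) = 1" using assms(2) by (auto simp: inner_def)
  have nz: "hook_prod t ?w \<noteq> 0" "hook_prod t (swap_word 1 (x - 1) ?w) \<noteq> 0"
    using hook_prod_nonzero m maya_swap_word t by metis+
  define P where "P = (\<Prod>y\<in>outer ?w. of_int (x - y) :: rat)"
  define Q where "Q = (\<Prod>x'\<in>inner ?w - {x}. of_int (x - x') :: rat)"
  have Q: "Q \<noteq> 0" using finite_inner_outer[OF m] by (simp add: Q_def)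
  have "box_weight ?w x = P / Q" by (simp add: box_weight_def weight_def P_def Q_def)
  moreover have "hook_prod t (swap_word 1 (x - 1) ?w) * P = of_nat t * hook_prod t ?w * Q"
    using hook_prod_swap[OF m x, of t] by (simp add: P_def Q_def)
  ultimately have "hook_prod t (swap_word 1 (x - 1) ?w) * box_weight ?w x = of_nat t * hook_prod t ?w"
    using Q by simp
  then have "1 / hook_prod t (swap_word 1 (x - 1) ?w) =
      1 / hook_prod t ?w * (box_weight ?w x / of_nat t)"
    using nz t by (simp add: field_simps)
  then have "1 / hook_prod t (qword t (add_at t p i x) i) =
      1 / hook_prod t ?w * (box_weight ?w x / of_nat t)"
    using qword_add_at[OF assms assms(3)] by simp
  then show ?thesis
    unfolding G[OF assms(1)] G[OF add_at(1)[OF assms(1,2)]]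
    using rest assms(3) by (simp add: prod.remove[of "{..<t}" i])
qed

lemma q_add_at:
  assumes "is_partition p" "x \<in> inner (qword t p i)" "i < t" "i' < t"
  defines "c \<equiv> x - charge (qword t p i)"
  shows "q k (t_quotient t (add_at t p i x) i') = q k (t_quotient t p i') +
    (if i' = i then of_int ((c + 1) ^ k + (c - 1) ^ k - 2 * c ^ k) else 0)"
proof -
  have t: "t > 0" using assms(3) by simp
  have "qword t p i (x - 1) = 0" "qword t p i (x - 1 + 1) = 1" using assms(2) by (auto simp: inner_def)
  note q_word_swap[OF maya_qword[OF assms(1) t] this, of k]
  then show ?thesis
    unfolding q_quotient[OF assms(1) t] q_quotient[OF add_at(1)[OF assms(1,2)] t] qword_add_at[OF assms(1-4)]
    by (simp add: c_def)
qed

text \<open>Induction over the construction of \<open>f\<close>. The generators lose weight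
  \<open>2\<close> by the second difference, and the discrete product rule carries this loss to
  products.\<close>

lemma wt_difference:
  assumes "wt t n f" "i < t"
  shows "\<exists>F. wtx t (n - 2) F \<and> (\<forall>p x. is_partition p \<longrightarrow> x \<in> inner (qword t p i) \<longrightarrow>
    f (add_at t p i x) - f p = F p (x - charge (qword t p i)))"
  using assms(1)
proof induction
  case (wt_q i' k n)
  show ?case
  proof (cases "i' = i")
    case True
    show ?thesis
      using wtx_mono[OF wtx_second_difference(1)[of t k], of "n - 2"] wt_q q_add_at assms(2)
      by (intro exI[of _ "\<lambda>p x. of_int ((x + 1) ^ k + (x - 1) ^ k - 2 * x ^ k)"]) (simp add: True)
  next
    case False
    then show ?thesis
      using wt_q q_add_at assms(2) by (intro exI[of _ "\<lambda>p x. 0"]) (simp add: wtx_wt[OF wt_zero])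
  qed
next
  case (wt_add n f g)
  then obtain F F' where F: "wtx t (n - 2) F" "wtx t (n - 2) F'"
    and d: "\<forall>p x. is_partition p \<longrightarrow> x \<in> inner (qword t p i) \<longrightarrow>
      f (add_at t p i x) - f p = F p (x - charge (qword t p i))"
      "\<forall>p x. is_partition p \<longrightarrow> x \<in> inner (qword t p i) \<longrightarrow>
      g (add_at t p i x) - g p = F' p (x - charge (qword t p i))" by blast
  show ?case
    by (rule exI[of _ "\<lambda>p x. F p x + F' p x"])
      (use wtx_add[OF F] d in \<open>simp add: add_diff_add\<close>)
next
  case (wt_mult m f n g)
  then obtain F F' where F: "wtx t (m - 2) F" "wtx t (n - 2) F'"
    and d: "\<forall>p x. is_partition p \<longrightarrow> x \<in> inner (qword t p i) \<longrightarrow>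
      f (add_at t p i x) - f p = F p (x - charge (qword t p i))"
      "\<forall>p x. is_partition p \<longrightarrow> x \<in> inner (qword t p i) \<longrightarrow>
      g (add_at t p i x) - g p = F' p (x - charge (qword t p i))" by blast
  \<comment> \<open>Unlike a derivative, a difference also produces the product of both changes; its
    weight is even \<open>m + n - 4\<close>.\<close>
  have "wtx t (m + n - 2) (\<lambda>p x. F p x * g p + (f p * F' p x + F p x * F' p x))"
    by (intro wtx_add wtx_mono[OF wtx_mult[OF F(1) wtx_wt[OF wt_mult(2)]]]
        wtx_mono[OF wtx_mult[OF wtx_wt[OF wt_mult(1)] F(2)]] wtx_mono[OF wtx_mult[OF F]]) auto
  moreover have "f (add_at t p i x) * g (add_at t p i x) - f p * g p =
      F p c * g p + (f p * F' p c + F p c * F' p c)"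
    if "is_partition p" "x \<in> inner (qword t p i)" "c = x - charge (qword t p i)" for p x c
  proof -
    have "f (add_at t p i x) = f p + F p c" "g (add_at t p i x) = g p + F' p c"
      using d that(1,2) unfolding that(3) by (simp_all add: algebra_simps)
    then show ?thesis by (simp add: algebra_simps)
  qed
  ultimately show ?case by blast
next
  case (wt_mono m f n)
  then show ?case using wtx_mono[of t "m - 2" _ "n - 2"] by force
qed (auto intro: exI[of _ "\<lambda>p x. 0"] wtx_wt[OF wt_zero])

section \<open>Averages over the boxes that can be added\<close>

lemma box_weight_moments:
  assumes "maya w"
  defines "mom \<equiv> \<lambda>n. \<Sum>x\<in>inner w. box_weight w x * of_int (x - charge w) ^ n"
  shows "mom 0 = 1" "of_nat n * mom n = (\<Sum>s=1..n. of_int (q_word s w) * mom (n - s))"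
proof -
  let ?f = "\<lambda>m. of_int (m - charge w) :: rat"
  have inj: "inj_on ?f (inner w)" by (auto intro: inj_onI)
  note * = moment_recursion[OF finite_inner_outer[OF assms(1)] card_inner[OF assms(1)] inj]
  show "mom 0 = 1" using *(1) by (simp add: mom_def box_weight_def)
  show "of_nat n * mom n = (\<Sum>s=1..n. of_int (q_word s w) * mom (n - s))"
    using *(2)[of n] by (simp add: mom_def box_weight_def q_word_def)
qed

text \<open>Strong induction along the Newton recursion, whose summand for \<open>s\<close> has
  weight \<open>s + (n - s)\<close>. The recursion is carried out on functions, because one
  \<open>h\<close> must serve all partitions.\<close>

lemma wt_moment:
  assumes "i < t"
  shows "\<exists>h. wt t (int n) h \<and> (\<forall>p. is_partition p \<longrightarrow>
    (\<Sum>x\<in>inner (qword t p i). box_weight (qword t p i) x * of_int (x - charge (qword t p i)) ^ n) = h p)"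
proof (induction n rule: less_induct)
  case (less n)
  have t: "t > 0" using assms by simp
  define mom where "mom p n =
    (\<Sum>x\<in>inner (qword t p i). box_weight (qword t p i) x * of_int (x - charge (qword t p i)) ^ n)" for p n
  have rec: "mom p 0 = 1"
    "of_nat n * mom p n = (\<Sum>s=1..n. of_int (q_word s (qword t p i)) * mom p (n - s))"
    if "is_partition p" for p n
    using box_weight_moments[OF maya_qword[OF that t, of i]] by (simp_all add: mom_def)
  have "\<forall>m<n. \<exists>h. wt t (int m) h \<and> (\<forall>p. is_partition p \<longrightarrow> mom p m = h p)"
    using less.IH by (simp add: mom_def)
  then obtain h where h: "\<And>m. m < n \<Longrightarrow> wt t (int m) (h m)"
    "\<And>m p. m < n \<Longrightarrow> is_partition p \<Longrightarrow> mom p m = h m p" by metis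
  have "\<exists>h. wt t (int n) h \<and> (\<forall>p. is_partition p \<longrightarrow> mom p n = h p)"
  proof (cases "n = 0")
    case True
    then show ?thesis
      by (intro exI[of _ "\<lambda>p. 1"]) (simp add: wt_const rec(1))
  next
    case False
    define H where "H p = 1 / of_nat n * (\<Sum>s=1..n. q s (t_quotient t p i) * h (n - s) p)" for p
    have "wt t (int n) H"
      unfolding H_def
    proof (intro wt_scale wt_sum)
      fix s assume s: "s \<in> {1..n}"
      then have "wt t (int s + int (n - s)) (\<lambda>p. q s (t_quotient t p i) * h (n - s) p)"
        using assms by (intro wt_mult wt_q h) auto
      then show "wt t (int n) (\<lambda>p. q s (t_quotient t p i) * h (n - s) p)" using s by simp
    qed simp
    moreover have "mom p n = H p" if p: "is_partition p" for p
    proof -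
      have "of_nat n * mom p n = (\<Sum>s=1..n. of_int (q_word s (qword t p i)) * mom p (n - s))"
        by (rule rec(2)[OF p])
      also have "\<dots> = (\<Sum>s=1..n. q s (t_quotient t p i) * h (n - s) p)"
        by (rule sum.cong) (use h(2) p t in \<open>auto simp: q_quotient\<close>)
      finally show ?thesis using False by (simp add: H_def field_simps)
    qed
    ultimately show ?thesis by blast
  qed
  then show ?case by (simp add: mom_def)
qed

text \<open>The coefficients do not depend on the corner and leave the sum. What remains of
  \<open>x ^ r\<close> is the \<open>r\<close>-th moment, again of weight \<open>r\<close>, so
  averaging costs no weight.\<close>

lemma wt_weighted_sum:
  assumes "wtx t n F" "i < t"
  shows "\<exists>h. wt t n h \<and> (\<forall>p. is_partition p \<longrightarrow>
    (\<Sum>x\<in>inner (qword t p i). box_weight (qword t p i) x * F p (x - charge (qword t p i))) = h p)"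
  using assms(1)
proof induction
  case (wtx_base n a r)
  obtain h where h: "wt t (int r) h" "\<forall>p. is_partition p \<longrightarrow>
    (\<Sum>x\<in>inner (qword t p i). box_weight (qword t p i) x * of_int (x - charge (qword t p i)) ^ r) = h p"
    using wt_moment[OF assms(2)] by blast
  have "(\<Sum>x\<in>inner (qword t p i). box_weight (qword t p i) x * (a p * of_int (x - charge (qword t p i)) ^ r))
      = a p * h p" if "is_partition p" for p
    using h(2)[rule_format, OF that, symmetric] by (simp add: sum_distrib_left mult_ac)
  then show ?case using wt_mult[OF wtx_base h(1)] by blast
next
  case (wtx_add n F F')
  then obtain h h' where h: "wt t n h" "\<forall>p. is_partition p \<longrightarrow>
    (\<Sum>x\<in>inner (qword t p i). box_weight (qword t p i) x * F p (x - charge (qword t p i))) = h p"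
    "wt t n h'" "\<forall>p. is_partition p \<longrightarrow>
    (\<Sum>x\<in>inner (qword t p i). box_weight (qword t p i) x * F' p (x - charge (qword t p i))) = h' p"
    by blast
  then show ?case
    using wt_add[OF h(1,3)] by (intro exI[of _ "\<lambda>p. h p + h' p"]) (simp add: distrib_left sum.distrib)
next
  case (wtx_mono m F n)
  then show ?case using wt_mono by blast
qed

lemma D_t_wt:
  assumes "wt t n f" "t > 0"
  shows "\<exists>g. wt t (n - 2) g \<and> (\<forall>p. is_partition p \<longrightarrow> D_t t (\<lambda>p. G t p * f p) p = G t p * g p)"
proof -
  have "\<forall>i<t. \<exists>F. wtx t (n - 2) F \<and> (\<forall>p x. is_partition p \<longrightarrow> x \<in> inner (qword t p i) \<longrightarrow>
    f (add_at t p i x) - f p = F p (x - charge (qword t p i)))"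
    using wt_difference[OF assms(1)] by blast
  then obtain F where F: "\<And>i. i < t \<Longrightarrow> wtx t (n - 2) (F i)"
    "\<And>i p x. i < t \<Longrightarrow> is_partition p \<Longrightarrow> x \<in> inner (qword t p i) \<Longrightarrow>
      f (add_at t p i x) - f p = F i p (x - charge (qword t p i))" by metis
  have "\<forall>i<t. \<exists>h. wt t (n - 2) h \<and> (\<forall>p. is_partition p \<longrightarrow>
    (\<Sum>x\<in>inner (qword t p i). box_weight (qword t p i) x * F i p (x - charge (qword t p i))) = h p)"
    using wt_weighted_sum[OF F(1)] by blast
  then obtain h where h: "\<And>i. i < t \<Longrightarrow> wt t (n - 2) (h i)"
    "\<And>i p. i < t \<Longrightarrow> is_partition p \<Longrightarrow>
      (\<Sum>x\<in>inner (qword t p i). box_weight (qword t p i) x * F i p (x - charge (qword t p i))) = h i p"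
    by metis
  define g where "g p = 1 / of_nat t * (\<Sum>i<t. h i p)" for p
  have "wt t (n - 2) g" unfolding g_def by (intro wt_scale wt_sum h) auto
  moreover have "D_t t (\<lambda>p. G t p * f p) p = G t p * g p" if p: "is_partition p" for p
  proof -
    have "(\<Sum>x\<in>inner (qword t p i). G t (add_at t p i x) * f (add_at t p i x)) =
        G t p / of_nat t * (f p + h i p)" if i: "i < t" for i
    proof -
      let ?w = "qword t p i"
      have "(\<Sum>x\<in>inner ?w. G t (add_at t p i x) * f (add_at t p i x)) =
          (\<Sum>x\<in>inner ?w. G t p / of_nat t * (f p * box_weight ?w x + box_weight ?w x * F i p (x - charge ?w)))"
      proof (rule sum.cong[OF refl])
        fix x assume x: "x \<in> inner ?w"
        have "f (add_at t p i x) = f p + F i p (x - charge ?w)"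
          using F(2)[OF i p x] by (simp add: algebra_simps)
        then show "G t (add_at t p i x) * f (add_at t p i x) =
          G t p / of_nat t * (f p * box_weight ?w x + box_weight ?w x * F i p (x - charge ?w))"
          by (simp add: G_add_at[OF p x i] field_simps)
      qed
      also have "\<dots> = G t p / of_nat t * (f p * (\<Sum>x\<in>inner ?w. box_weight ?w x) + h i p)"
        by (simp only: sum_distrib_left[symmetric] sum.distrib h(2)[OF i p])
      also have "(\<Sum>x\<in>inner ?w. box_weight ?w x) = 1"
        using box_weight_moments(1)[OF maya_qword[OF p assms(2)], of i] by simp
      finally show ?thesis by simp
    qed
    \<comment> \<open>The term \<open>f p\<close> now occurs \<open>t\<close> times with the factor
      \<open>G t p / of_nat t\<close>, which cancels against the subtracted
      \<open>G t p * f p\<close>.\<close>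
    then have "D_t t (\<lambda>p. G t p * f p) p = (\<Sum>i<t. G t p / of_nat t * (f p + h i p)) - G t p * f p"
      unfolding D_t_def sum_adds_hook[OF p assms(2)] by simp
    also have "\<dots> = G t p * g p"
      unfolding sum_distrib_left[symmetric] sum.distrib g_def using assms(2)
      by (simp add: field_simps)
    finally show ?thesis .
  qed
  ultimately show ?thesis by blast
qed

text \<open>Needed for iteration: the formula for \<open>D_t\<close> is known on partitions only,
  and adding a hook does not leave them.\<close>

lemma D_t_cong:
  assumes "\<And>p. is_partition p \<Longrightarrow> f p = g p" "is_partition p"
  shows "D_t t f p = D_t t g p"
proof -
  have "(\<Sum>p' | adds_hook t p p'. f p') = (\<Sum>p' | adds_hook t p p'. g p')"
    by (rule sum.cong) (use assms in \<open>auto simp: adds_hook_def\<close>)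
  with assms show ?thesis by (simp add: D_t_def)
qed

lemma D_t_power_wt:
  assumes "wt t n f" "t > 0"
  shows "\<exists>g. wt t (n - 2 * int r) g \<and>
    (\<forall>p. is_partition p \<longrightarrow> (D_t t ^^ r) (\<lambda>p. G t p * f p) p = G t p * g p)"
proof (induction r)
  case 0
  then show ?case using assms by auto
next
  case (Suc r)
  then obtain g where g: "wt t (n - 2 * int r) g"
    "\<And>p. is_partition p \<Longrightarrow> (D_t t ^^ r) (\<lambda>p. G t p * f p) p = G t p * g p" by blast
  obtain g' where "wt t (n - 2 * int r - 2) g'"
    "\<And>p. is_partition p \<Longrightarrow> D_t t (\<lambda>p. G t p * g p) p = G t p * g' p"
    using D_t_wt[OF g(1) assms(2)] by blast
  moreover have "(D_t t ^^ Suc r) (\<lambda>p. G t p * f p) p = D_t t (\<lambda>p. G t p * g p) p"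
    if "is_partition p" for p
    using D_t_cong[OF g(2) that] by simp
  ultimately show ?case by (intro exI[of _ g']) (simp add: algebra_simps)
qed

text \<open>No tuple of partitions has negative total size, so the linear combination representing
  \<open>f\<close> is empty.\<close>

lemma wt_negative:
  assumes "wt t n f" "n < 0"
  shows "f p = 0"
proof -
  have "\<delta> \<notin> indices t n" for \<delta>
  proof
    assume "\<delta> \<in> indices t n"
    then have "int (\<Sum>i<t. sum_list (\<delta> i)) \<le> n" by (simp only: indices_iff)
    with assms(2) show False by linarith
  qed
  then have "indices t n = {}" by blast
  then show ?thesis using wt_imp_spanned[OF assms(1)] by (simp add: spanned_def)
qed

theorem theorem3p3:
  fixes t :: nat and \<nu> :: "nat list"
  assumes "t > 0" and "is_partition \<nu>"
  shows "(\<exists>b :: (nat \<Rightarrow> nat list) \<Rightarrow> rat. \<forall>p. is_partition p \<longrightarrow>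
            D_t t (\<lambda>p. G t p * (\<Prod>i<t. q_part (t_quotient t \<nu> i) (t_quotient t p i))) p =
            (\<Sum>\<delta> | \<delta> \<in> {..<t} \<rightarrow>\<^sub>E Collect is_partition \<and>
                   (\<Sum>i<t. sum_list (\<delta> i)) + 2 \<le> (\<Sum>i<t. sum_list (t_quotient t \<nu> i)).
               b \<delta> * (G t p * (\<Prod>i<t. q_part (\<delta> i) (t_quotient t p i)))))
       \<and> (\<forall>r p. real r \<ge> 1 / 2 * real (\<Sum>i<t. sum_list (t_quotient t \<nu> i)) + 1 \<longrightarrow> is_partition p \<longrightarrow>
            (D_t t ^^ r) (\<lambda>p. G t p * (\<Prod>i<t. q_part (t_quotient t \<nu> i) (t_quotient t p i))) p = 0)"
proof -
  define f where "f p = (\<Prod>i<t. q_part (t_quotient t \<nu> i) (t_quotient t p i))" for p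
  define N where "N = (\<Sum>i<t. sum_list (t_quotient t \<nu> i))"
  have "wt t (\<Sum>i<t. int (sum_list (t_quotient t \<nu> i))) f"
    unfolding f_def
    by (intro wt_prod wt_q_part) (use t_quotient(1)[OF assms(2,1)] in \<open>auto simp: is_partition_def\<close>)
  then have f: "wt t (int N) f" by (simp add: N_def)
  obtain g where g: "wt t (int N - 2) g"
    "\<And>p. is_partition p \<Longrightarrow> D_t t (\<lambda>p. G t p * f p) p = G t p * g p"
    using D_t_wt[OF f assms(1)] by blast
  obtain b where b: "\<And>p. g p = (\<Sum>\<delta>\<in>indices t (int N - 2). b \<delta> * monomial t \<delta> p)"
    using wt_imp_spanned[OF g(1)] by (auto simp: spanned_def)
  \<comment> \<open>The integer bound \<open>N - 2\<close> is rewritten additively over the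
    naturals, so that truncated subtraction does not interfere when \<open>N < 2\<close>.\<close>
  have ind: "indices t (int N - 2) =
      {\<delta>. \<delta> \<in> {..<t} \<rightarrow>\<^sub>E Collect is_partition \<and> (\<Sum>i<t. sum_list (\<delta> i)) + 2 \<le> N}"
    unfolding indices_def by (rule Collect_cong, rule conj_cong[OF refl]) linarith
  have "D_t t (\<lambda>p. G t p * f p) p = (\<Sum>\<delta> | \<delta> \<in> {..<t} \<rightarrow>\<^sub>E Collect is_partition \<and>
      (\<Sum>i<t. sum_list (\<delta> i)) + 2 \<le> N. b \<delta> * (G t p * (\<Prod>i<t. q_part (\<delta> i) (t_quotient t p i))))"
    if "is_partition p" for p
    unfolding g(2)[OF that] b ind monomial_def sum_distrib_left by (simp only: mult_ac)
  moreover have "(D_t t ^^ r) (\<lambda>p. G t p * f p) p = 0"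
    if r: "real r \<ge> 1 / 2 * real N + 1" and p: "is_partition p" for r p
  proof -
    \<comment> \<open>Each application of the operator costs weight \<open>2\<close>; the hypothesis
      on \<open>r\<close> pushes the weight \<open>N - 2 * r\<close> below \<open>0\<close>.\<close>
    obtain h where h: "wt t (int N - 2 * int r) h"
      "(D_t t ^^ r) (\<lambda>p. G t p * f p) p = G t p * h p"
      using D_t_power_wt[OF f assms(1), of r] p by blast
    have "int N - 2 * int r < 0" using r by linarith
    then show ?thesis using h wt_negative by simp
  qed
  ultimately show ?thesis unfolding f_def N_def by blast
qed

end
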